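(* Let $G=(V,E)$ be an undirected graph with edge costs $c:E\to\mathbb{R}_+$ and terminal set $W\subseteq V$, and let $T$ be a hub tree with edge capacities $b:E(T)\to\mathbb{R}_+$. Then among all hierarchical hubbings for $\mathcal{U}(T^b)$ into $G$, there is a minimum-cost one that is a $T$-hubbing; i.e., the optimal hierarchical hubbing for $\mathcal{U}(T^b)$ is a $T$-hubbing.
   Context: Demands are symmetric: a demand pattern is a vector $D\in\mathbb{R}_+^{\binom{W}{2}}$ indexed by unordered pairs of terminals. A hub tree is a tree whose leaf set is exactly $W$. For a hub tree $T'$ and $\{i,j\}\subseteq W$, let $T'_{ij}$ be the unique $i$-$j$ path in $T'$. $\mathcal{U}(T^b)$ is the set of all $D\in\mathbb{R}_+^{\binom{W}{2}}$ with $\sum_{\{i,j\}: f\in T_{ij}} D_{ij}\le b(f)$ for every $f\in E(T)$. For a hub tree $T'$, a $T'$-embedding into $G$ is a map $\phi$ assigning to each $v\in V(T')$ a vertex $\phi(v)\in V$, with $\phi(i)=i$ for all $i\in W$, and to each edge $vw\in E(T')$ a simple $\phi(v)$-$\phi(w)$ path $\phi(vw)$ in $G$. Given a convex universe $\mathcal{U}\subseteq\mathbb{R}_+^{\binom{W}{2}}$, a $T'$-hubbing for $\mathcal{U}$ into $G$ is a pair $(\phi,u)$ with $\phi$ a $T'$-embedding and $u:E\to\mathbb{R}_+$ satisfying $u(e)\ge\sum_{f\in E(T'):\, e\in\phi(f)}\beta(f)$ for all $e\in E$, where $\beta(f)=\max_{D\in\mathcal{U}}\sum_{\{i,j\}:\,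 f\in T'_{ij}} D_{ij}$. A hierarchical hubbing for $\mathcal{U}$ is a $T'$-hubbing for $\mathcal{U}$ for some hub tree $T'$. Its cost is $\sum_{e\in E}c(e)u(e)$. *)

theory Defs
  imports Complex_Main
begin

definition is_graph :: "'v set \<Rightarrow> 'v set set \<Rightarrow> bool" where
  "is_graph V E \<longleftrightarrow> finite V \<and> (\<forall>e\<in>E. e \<subseteq> V \<and> (\<exists>x y. x \<noteq> y \<and> e = {x, y}))"

definition walk :: "'v set set \<Rightarrow> 'v list \<Rightarrow> bool" where
  "walk E p \<longleftrightarrow> p \<noteq> [] \<and> (\<forall>k < length p - 1. {p ! k, p ! Suc k} \<in> E)"

definition spath :: "'v set \<Rightarrow> 'v set set \<Rightarrow> 'v list \<Rightarrow> 'v \<Rightarrow> 'v \<Rightarrow> bool" where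
  "spath V E p x y \<longleftrightarrow> walk E p \<and> set p \<subseteq> V \<and> distinct p \<and> hd p = x \<and> last p = y"

definition path_edges :: "'v list \<Rightarrow> 'v set set" where
  "path_edges p = {{p ! k, p ! Suc k} | k. k < length p - 1}"

definition connected_graph :: "'v set \<Rightarrow> 'v set set \<Rightarrow> bool" where
  "connected_graph V E \<longleftrightarrow> (\<forall>x\<in>V. \<forall>y\<in>V. \<exists>p. spath V E p x y)"

definition has_cycle :: "'v set set \<Rightarrow> bool" where
  "has_cycle E \<longleftrightarrow> (\<exists>p. 3 \<le> length p \<and> distinct p \<and> walk E p \<and> {last p, hd p} \<in> E)"

definition is_tree :: "'v set \<Rightarrow> 'v set set \<Rightarrow> bool" where
  "is_tree V E \<longleftrightarrow> is_graph V E \<and> V \<noteq> {} \<and> connected_graph V E \<and> \<not> has_cycle E"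

definition leaves :: "'v set \<Rightarrow> 'v set set \<Rightarrow> 'v set" where
  "leaves V E = {v \<in> V. card {e \<in> E. v \<in> e} = 1}"

text \<open>A hub tree for terminal set W: a (finite) tree whose leaf set is exactly W.
  Tree vertices have type 'a + nat; terminal i is the vertex Inl i, further
  (Steiner) vertices may be any other element of the type.\<close>
definition hub_tree :: "'a set \<Rightarrow> ('a + nat) set \<Rightarrow> ('a + nat) set set \<Rightarrow> bool" where
  "hub_tree W VT ET \<longleftrightarrow> is_tree VT ET \<and> leaves VT ET = Inl ` W"

definition tree_path :: "'v set \<Rightarrow> 'v set set \<Rightarrow> 'v \<Rightarrow> 'v \<Rightarrow> 'v list" where
  "tree_path V E x y = (THE p. spath V E p x y)"

definition tpairs :: "'a set \<Rightarrow> 'a set set" where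
  "tpairs W = {{i, j} | i j. i \<in> W \<and> j \<in> W \<and> i \<noteq> j}"

definition on_tpath :: "('a + nat) set \<Rightarrow> ('a + nat) set set \<Rightarrow> 'a set \<Rightarrow> ('a + nat) set \<Rightarrow> bool" where
  "on_tpath VT ET p f \<longleftrightarrow> (\<exists>i j. p = {i, j} \<and> f \<in> path_edges (tree_path VT ET (Inl i) (Inl j)))"

text \<open>Demand patterns: D :: 'a set \<Rightarrow> real, indexed by unordered terminal pairs.\<close>
definition load :: "'a set \<Rightarrow> ('a + nat) set \<Rightarrow> ('a + nat) set set \<Rightarrow> ('a set \<Rightarrow> real) \<Rightarrow> ('a + nat) set \<Rightarrow> real" where
  "load W VT ET D f = (\<Sum>p\<in>{p \<in> tpairs W. on_tpath VT ET p f}. D p)"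

definition UTb :: "'a set \<Rightarrow> ('a + nat) set \<Rightarrow> ('a + nat) set set \<Rightarrow> (('a + nat) set \<Rightarrow> real) \<Rightarrow> ('a set \<Rightarrow> real) set" where
  "UTb W VT ET b = {D. (\<forall>p. 0 \<le> D p) \<and> (\<forall>p. p \<notin> tpairs W \<longrightarrow> D p = 0)
                      \<and> (\<forall>f\<in>ET. load W VT ET D f \<le> b f)}"

definition beta :: "('a set \<Rightarrow> real) set \<Rightarrow> 'a set \<Rightarrow> ('a + nat) set \<Rightarrow> ('a + nat) set set \<Rightarrow> ('a + nat) set \<Rightarrow> real" where
  "beta U W VT ET f = Sup ((\<lambda>D. load W VT ET D f) ` U)"

definition embedding ::
  "'a set \<Rightarrow> 'a set set \<Rightarrow> 'a set \<Rightarrow> ('a + nat) set \<Rightarrow> ('a + nat) set set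
    \<Rightarrow> ('a + nat \<Rightarrow> 'a) \<Rightarrow> (('a + nat) set \<Rightarrow> 'a list) \<Rightarrow> bool" where
  "embedding V E W VT ET phv phe \<longleftrightarrow>
     (\<forall>v\<in>VT. phv v \<in> V) \<and> (\<forall>i\<in>W. phv (Inl i) = i) \<and>
     (\<forall>v w. {v, w} \<in> ET \<longrightarrow>
        spath V E (phe {v, w}) (phv v) (phv w) \<or> spath V E (phe {v, w}) (phv w) (phv v))"

definition hubbing ::
  "('a set \<Rightarrow> real) set \<Rightarrow> 'a set \<Rightarrow> 'a set set \<Rightarrow> 'a set \<Rightarrow> ('a + nat) set \<Rightarrow> ('a + nat) set set
    \<Rightarrow> ('a + nat \<Rightarrow> 'a) \<Rightarrow> (('a + nat) set \<Rightarrow> 'a list) \<Rightarrow> ('a set \<Rightarrow> real) \<Rightarrow> bool" where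
  "hubbing U V E W VT ET phv phe u \<longleftrightarrow>
     embedding V E W VT ET phv phe \<and>
     (\<forall>e\<in>E. 0 \<le> u e \<and>
        (\<Sum>f\<in>{f \<in> ET. e \<in> path_edges (phe f)}. beta U W VT ET f) \<le> u e)"

definition hub_cost :: "'a set set \<Rightarrow> ('a set \<Rightarrow> real) \<Rightarrow> ('a set \<Rightarrow> real) \<Rightarrow> real" where
  "hub_cost E c u = (\<Sum>e\<in>E. c e * u e)"

end

theory Submission
  imports Defs "HOL-Analysis.Analysis"
begin

text \<open>
  An edge \<open>f'\<close> of an arbitrary hub tree \<open>T'\<close> splits the terminals in two, and by max-flow min-cut in
  the capacitated tree \<open>T\<close> the capacity \<open>\<beta>(f')\<close> is at least that of a minimum cut \<open>X f'\<close> of \<open>T\<close>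
  inducing the same split. Inclusion-minimal minimum cuts uncross, so the family of all \<open>X f'\<close> is
  laminar in the same way as the sides of the edges of \<open>T'\<close>, and there is a map \<open>\<psi>\<close> from
  the vertices of \<open>T\<close> to those of \<open>T'\<close>, fixing the terminals, that pulls the side of \<open>f'\<close> back to
  \<open>X f'\<close>. Embed \<open>T\<close> by composing \<open>\<psi>\<close> with the given embedding of \<open>T'\<close> and route an edge of \<open>T\<close> along
  the images of the edges of \<open>T'\<close> between the \<open>\<psi>\<close>-images of its ends. The image of \<open>f'\<close> is
  then charged exactly the capacity of the cut \<open>X f'\<close>, hence at most \<open>\<beta>(f')\<close>, so every hubbing
  yields a \<open>T\<close>-hubbing of no greater cost. Finally, only finitely many costs arise from
  \<open>T\<close>-embeddings, so the minimum is attained.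
\<close>

section \<open>Edge sets of paths, connectivity, and uniqueness of paths in acyclic graphs\<close>

lemma path_edges_single [simp]: "path_edges [x] = {}"
  by (simp add: path_edges_def)

lemma path_edges_mono_append:
  "path_edges xs \<subseteq> path_edges (xs @ ys)" "path_edges ys \<subseteq> path_edges (xs @ ys)"
proof -
  show "path_edges xs \<subseteq> path_edges (xs @ ys)"
  proof
    fix f assume "f \<in> path_edges xs"
    then obtain k where k: "k < length xs - 1" "f = {xs ! k, xs ! Suc k}"
      by (auto simp: path_edges_def)
    then have "f = {(xs @ ys) ! k, (xs @ ys) ! Suc k}" "k < length (xs @ ys) - 1"
      by (auto simp: nth_append)
    then show "f \<in> path_edges (xs @ ys)" by (auto simp: path_edges_def)
  qed
  show "path_edges ys \<subseteq> path_edges (xs @ ys)"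
  proof
    fix f assume "f \<in> path_edges ys"
    then obtain k where k: "k < length ys - 1" "f = {ys ! k, ys ! Suc k}"
      by (auto simp: path_edges_def)
    then have "f = {(xs @ ys) ! (length xs + k), (xs @ ys) ! Suc (length xs + k)}"
      "length xs + k < length (xs @ ys) - 1"
      by (auto simp: nth_append)
    then show "f \<in> path_edges (xs @ ys)" unfolding path_edges_def by blast
  qed
qed

lemma path_edges_Cons [simp]:
  "path_edges (x # y # p) = insert {x, y} (path_edges (y # p))"
proof -
  have "path_edges (x # y # p) \<subseteq> insert {x, y} (path_edges (y # p))"
  proof
    fix f assume "f \<in> path_edges (x # y # p)"
    then obtain k where k: "k < Suc (length p)" "f = {(x # y # p) ! k, (x # y # p) ! Suc k}"
      by (auto simp: path_edges_def)
    then show "f \<in> insert {x, y} (path_edges (y # p))"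
      by (cases k) (auto simp: path_edges_def)
  qed
  moreover have "{x, y} \<in> path_edges (x # y # p)"
    by (auto simp: path_edges_def intro!: exI[of _ "0::nat"])
  moreover have "path_edges (y # p) \<subseteq> path_edges (x # y # p)"
    using path_edges_mono_append(2)[of "y # p" "[x]"] by simp
  ultimately show ?thesis by blast
qed

lemma path_edges_snoc:
  assumes "p \<noteq> []"
  shows "path_edges (p @ [z]) = insert {last p, z} (path_edges p)"
  using assms
proof (induction p rule: induct_list012)
  case (3 x y zs)
  then show ?case by auto
qed auto

lemma finite_path_edges [simp]: "finite (path_edges p)"
  by (simp add: path_edges_def)

lemma Union_path_edges: "\<Union> (path_edges p) \<subseteq> set p"
  by (auto simp: path_edges_def)

lemma walk_iff: "walk F p \<longleftrightarrow> p \<noteq> [] \<and> path_edges p \<subseteq> F"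
  by (auto simp: walk_def path_edges_def)

text \<open>Connectivity is a closure rather than the existence of a path, so that deleting edges,
  mapping vertices and joining connections need no work on lists.\<close>

definition conn :: "'v set set \<Rightarrow> 'v \<Rightarrow> 'v \<Rightarrow> bool" where
  "conn F = (\<lambda>x y. {x, y} \<in> F)\<^sup>*\<^sup>*"

lemma conn_refl [simp]: "conn F x x"
  by (simp add: conn_def)

lemma conn_edge: "{x, y} \<in> F \<Longrightarrow> conn F x y"
  by (simp add: conn_def r_into_rtranclp)

lemma conn_trans [trans]: "conn F x y \<Longrightarrow> conn F y z \<Longrightarrow> conn F x z"
  by (simp add: conn_def)

lemma conn_sym: "conn F x y \<Longrightarrow> conn F y x"
  unfolding conn_def
proof (induction rule: rtranclp_induct)
  case (step y z)
  then show ?case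
    using converse_rtranclp_into_rtranclp[of "\<lambda>x y. {x, y} \<in> F" z y x] by (simp add: insert_commute)
qed simp

lemma conn_mono: "conn F x y \<Longrightarrow> F \<subseteq> F' \<Longrightarrow> conn F' x y"
  unfolding conn_def using rtranclp_mono[of "\<lambda>x y. {x, y} \<in> F" "\<lambda>x y. {x, y} \<in> F'"] by blast

lemma conn_induct [consumes 1, case_names refl step]:
  assumes "conn F x y" "P x"
    and "\<And>y z. conn F x y \<Longrightarrow> {y, z} \<in> F \<Longrightarrow> P y \<Longrightarrow> P z"
  shows "P y"
  using assms unfolding conn_def by (rule rtranclp_induct)

lemma conn_path_edges: "p \<noteq> [] \<Longrightarrow> conn (path_edges p) (hd p) (last p)"
proof (induction p rule: induct_list012)
  case (3 x y zs)
  then have "conn (path_edges (y # zs)) y (last (y # zs))" by simp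
  then have "conn (path_edges (x # y # zs)) y (last (y # zs))"
    by (rule conn_mono) auto
  moreover have "conn (path_edges (x # y # zs)) x y"
    by (rule conn_edge) auto
  ultimately show ?case by (auto intro: conn_trans)
qed auto

lemma spath_iff:
  "spath V E p x y \<longleftrightarrow> p \<noteq> [] \<and> path_edges p \<subseteq> E \<and> set p \<subseteq> V \<and> distinct p \<and> hd p = x \<and> last p = y"
  by (auto simp: spath_def walk_iff)

lemma spath_conn: "spath V E p x y \<Longrightarrow> conn (path_edges p) x y"
  using conn_path_edges[of p] by (auto simp: spath_iff)

text \<open>The way back from closures to simple paths: a path is prolonged by one edge, or cut off
  at the new vertex if it has been visited before.\<close>

lemma conn_spath:
  assumes "conn F x y" "x \<in> V" "\<Union> F \<subseteq> V"
  shows "\<exists>p. spath V F p x y"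
  using assms(1)
proof (induction rule: conn_induct)
  case refl
  then show ?case using assms by (intro exI[of _ "[x]"]) (auto simp: spath_iff)
next
  case (step y z)
  then obtain p where p: "spath V F p x y" by blast
  show ?case
  proof (cases "z \<in> set p")
    case True
    then obtain as bs where as: "p = as @ z # bs" by (meson split_list)
    have "path_edges (as @ [z]) \<subseteq> path_edges p"
      using path_edges_mono_append(1)[of "as @ [z]" bs] as by simp
    then have "spath V F (as @ [z]) x z"
      using p as by (cases as) (auto simp: spath_iff)
    then show ?thesis by blast
  next
    case False
    then have "spath V F (p @ [z]) x z"
      using p step.hyps assms(3) by (auto simp: spath_iff path_edges_snoc)
    then show ?thesis by blast
  qed
qed

text \<open>A simple path from \<open>u\<close> to \<open>v\<close> that avoids their edge has at
  least three vertices, and the edge closes it to a cycle.\<close>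

lemma bridge:
  assumes "\<not> has_cycle E" "\<Union> E \<subseteq> V" "{u, v} \<in> E" "u \<noteq> v"
  shows "\<not> conn (E - {{u, v}}) u v"
proof
  assume "conn (E - {{u, v}}) u v"
  moreover have "u \<in> V" using assms by auto
  moreover have "\<Union> (E - {{u, v}}) \<subseteq> V" using assms by auto
  ultimately obtain p where p: "spath V (E - {{u, v}}) p u v" using conn_spath by meson
  have "3 \<le> length p"
  proof (rule ccontr)
    assume "\<not> 3 \<le> length p"
    then have "length p = 0 \<or> length p = 1 \<or> length p = 2" by linarith
    then show False
      using p assms(4) by (auto simp: spath_iff length_Suc_conv numeral_2_eq_2)
  qed
  moreover have "walk E p" "distinct p" "{last p, hd p} \<in> E"
    using p assms(3) by (auto simp: spath_iff walk_iff insert_commute)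
  ultimately show False using assms(1) unfolding has_cycle_def by blast
qed

text \<open>If the paths leave \<open>x\<close> by different edges, then going along
  \<open>q\<close> to \<open>y\<close> and back along \<open>p\<close> reaches \<open>u\<close>
  without the edge \<open>{x, u}\<close>, which is a bridge.\<close>

lemma spath_unique:
  assumes "\<not> has_cycle E" "\<Union> E \<subseteq> V" "spath V E p x y" "spath V E q x y"
  shows "p = q"
  using assms(3,4)
proof (induction p arbitrary: q x)
  case Nil
  then show ?case by (simp add: spath_iff)
next
  case (Cons a p)
  have a: "a = x" using Cons.prems by (simp add: spath_iff)
  obtain q' where q: "q = x # q'" using Cons.prems by (cases q) (auto simp: spath_iff)
  show ?case
  proof (cases "x = y")
    case True
    then have "p = []" "q' = []"
      using Cons.prems a q by (auto simp: spath_iff split: if_splits)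
    then show ?thesis using a q by simp
  next
    case False
    then obtain u p' w q'' where p': "p = u # p'" and q'': "q' = w # q''"
      using Cons.prems a q by (cases p; cases q') (auto simp: spath_iff)
    have pe: "spath V E p u y" "{x, u} \<in> E" "x \<notin> set p" "x \<noteq> u"
      and qe: "spath V E q' w y" "{x, w} \<in> E" "x \<notin> set q'" "x \<noteq> w"
      using Cons.prems a q p' q'' by (auto simp: spath_iff)
    show ?thesis
    proof (cases "u = w")
      case True
      then show ?thesis using Cons.IH pe(1) qe(1) a q by blast
    next
      case False
      let ?F = "E - {{x, u}}"
      have "path_edges p \<subseteq> ?F" "path_edges q' \<subseteq> ?F"
        using pe qe Union_path_edges[of p] Union_path_edges[of q'] by (auto simp: spath_iff)
      then have "conn ?F u y" "conn ?F w y"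
        using spath_conn[OF pe(1)] spath_conn[OF qe(1)] conn_mono by metis+
      moreover have "conn ?F x w"
        using qe False by (intro conn_edge) (auto simp: doubleton_eq_iff)
      ultimately have "conn ?F x u"
        by (meson conn_trans conn_sym)
      then show ?thesis using bridge[OF assms(1,2) pe(2,4)] by blast
    qed
  qed
qed

section \<open>Sides of tree edges\<close>

text \<open>The root may be any vertex; it fixes which of the two components left by deleting an
  edge is called the side of that edge.\<close>

locale rooted_tree =
  fixes V :: "'v set" and E :: "'v set set" and r :: 'v
  assumes tree: "is_tree V E" and root: "r \<in> V"
begin

lemma acyclic_E: "\<not> has_cycle E" and edges_in_V: "\<Union> E \<subseteq> V" and finite_V: "finite V"
  using tree by (auto simp: is_tree_def is_graph_def)

lemma edge_ends:
  assumes "f \<in> E"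
  shows "\<exists>u v. u \<in> V \<and> v \<in> V \<and> u \<noteq> v \<and> f = {u, v}"
proof -
  have "f \<subseteq> V" "\<exists>u v. u \<noteq> v \<and> f = {u, v}"
    using tree assms unfolding is_tree_def is_graph_def by blast+
  then show ?thesis by blast
qed

lemma finite_E: "finite E"
  by (rule finite_subset[of _ "Pow V"]) (use edges_in_V finite_V in auto)

lemma tree_path_spath:
  assumes "x \<in> V" "y \<in> V"
  shows "spath V E (tree_path V E x y) x y"
proof -
  obtain p where p: "spath V E p x y"
    using tree assms by (auto simp: is_tree_def connected_graph_def)
  have "tree_path V E x y = p"
    unfolding tree_path_def
    using p spath_unique[OF acyclic_E edges_in_V] by (intro the_equality) auto
  then show ?thesis using p by simp
qed

lemma conn_E: "x \<in> V \<Longrightarrow> y \<in> V \<Longrightarrow> conn E x y"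
  using conn_mono[OF spath_conn[OF tree_path_spath]] tree_path_spath by (simp add: spath_iff)

lemma tree_path_edge_iff:
  assumes "x \<in> V" "y \<in> V"
  shows "f \<in> path_edges (tree_path V E x y) \<longleftrightarrow> \<not> conn (E - {f}) x y"
proof
  assume f: "f \<in> path_edges (tree_path V E x y)"
  show "\<not> conn (E - {f}) x y"
  proof
    assume "conn (E - {f}) x y"
    moreover have "\<Union> (E - {f}) \<subseteq> V" using edges_in_V by auto
    ultimately obtain q where q: "spath V (E - {f}) q x y"
      using conn_spath assms(1) by meson
    then have "spath V E q x y" by (auto simp: spath_iff)
    then have "q = tree_path V E x y"
      using spath_unique[OF acyclic_E edges_in_V] tree_path_spath[OF assms] by blast
    then show False using q f by (auto simp: spath_iff)
  qed
next
  assume *: "\<not> conn (E - {f}) x y"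
  show "f \<in> path_edges (tree_path V E x y)"
  proof (rule ccontr)
    assume "f \<notin> path_edges (tree_path V E x y)"
    then have "path_edges (tree_path V E x y) \<subseteq> E - {f}"
      using tree_path_spath[OF assms] by (auto simp: spath_iff)
    then show False using conn_mono[OF spath_conn[OF tree_path_spath[OF assms]]] * by simp
  qed
qed

definition side :: "'v set \<Rightarrow> 'v set" where
  "side f = {z \<in> V. \<not> conn (E - {f}) r z}"

lemma side_subset: "side f \<subseteq> V" and root_notin_side: "r \<notin> side f"
  by (auto simp: side_def)

lemma two_components:
  assumes "{u, v} \<in> E" "z \<in> V"
  shows "conn (E - {{u, v}}) u z \<or> conn (E - {{u, v}}) v z"
proof -
  have "conn E u z" using assms edges_in_V by (intro conn_E) auto
  then show ?thesis
  proof (induction rule: conn_induct)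
    case (step y z)
    show ?case
    proof (cases "{y, z} = {u, v}")
      case True
      then show ?thesis by (auto simp: doubleton_eq_iff)
    next
      case False
      then have "conn (E - {{u, v}}) y z" using step.hyps by (intro conn_edge) auto
      then show ?thesis using step.IH conn_trans by metis
    qed
  qed simp
qed

text \<open>Deleting an edge leaves exactly two components, so agreeing on the side means lying in
  the same one. This turns statements on tree paths into Boolean ones.\<close>

lemma side_iff:
  assumes "f \<in> E" "x \<in> V" "y \<in> V"
  shows "(x \<in> side f) = (y \<in> side f) \<longleftrightarrow> conn (E - {f}) x y"
proof -
  obtain u v where f: "f = {u, v}" using edge_ends assms(1) by blast
  have "conn (E - {f}) u z \<or> conn (E - {f}) v z" if "z \<in> V" for z
    using two_components[of u v z] that assms(1) f by blast
  from this[OF assms(2)] this[OF assms(3)] this[OF root]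
  show ?thesis using assms(2,3) unfolding side_def mem_Collect_eq
    by (meson conn_sym conn_trans)
qed

lemma tree_path_side_iff:
  assumes "f \<in> E" "x \<in> V" "y \<in> V"
  shows "f \<in> path_edges (tree_path V E x y) \<longleftrightarrow> (x \<in> side f) \<noteq> (y \<in> side f)"
  using side_iff[OF assms] tree_path_edge_iff[OF assms(2,3)] by blast

text \<open>Deleting another edge leaves \<open>u\<close> and \<open>v\<close> adjacent, while
  deleting their own edge disconnects them, as it is a bridge.\<close>

lemma edge_side_iff:
  assumes "{u, v} \<in> E" "g \<in> E"
  shows "(u \<in> side g) = (v \<in> side g) \<longleftrightarrow> g \<noteq> {u, v}"
proof -
  have uv: "u \<in> V" "v \<in> V" "u \<noteq> v"
    using assms edges_in_V edge_ends[OF assms(1)] by (auto simp: doubleton_eq_iff)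
  have "conn (E - {g}) u v \<longleftrightarrow> g \<noteq> {u, v}"
    using bridge[OF acyclic_E edges_in_V assms(1) uv(3)] assms conn_edge[of u v "E - {g}"]
    by blast
  then show ?thesis using side_iff[OF assms(2) uv(1,2)] by blast
qed

lemma separating_edge:
  assumes "x \<in> V" "y \<in> V" "x \<noteq> y"
  obtains f where "f \<in> E" "(x \<in> side f) \<noteq> (y \<in> side f)"
proof -
  have sp: "spath V E (tree_path V E x y) x y" by (rule tree_path_spath[OF assms(1,2)])
  then obtain u v p where "tree_path V E x y = u # v # p"
    using assms(3) by (cases "tree_path V E x y" rule: remdups_adj.cases) (auto simp: spath_iff)
  then have "{u, v} \<in> path_edges (tree_path V E x y)" "{u, v} \<in> E"
    using sp by (auto simp: spath_iff)
  then show ?thesis using that tree_path_side_iff[OF _ assms(1,2)] by blast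
qed

text \<open>Both ends of \<open>f\<close> lie on the same side of \<open>g\<close>. The other side
  of \<open>g\<close> is thus connected without using \<open>f\<close>, and so lies within one side
  of \<open>f\<close>.\<close>

lemma empty_quadrant:
  assumes "f \<in> E" "g \<in> E" "f \<noteq> g"
  shows "\<exists>s t. \<forall>x\<in>V. \<not> ((x \<in> side f) = s \<and> (x \<in> side g) = t)"
proof -
  obtain u v where f: "f = {u, v}" and uv: "u \<in> V" "v \<in> V" using edge_ends assms(1) by blast
  have uvg: "(u \<in> side g) = (v \<in> side g)" using edge_side_iff assms f by blast
  show ?thesis
  \<comment> \<open>\<open>k\<close> represents the part of \<open>g\<close> that does not contain
    the edge \<open>f\<close>.\<close>
  proof (cases "\<exists>k\<in>V. (k \<in> side g) \<noteq> (u \<in> side g)")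
    case True
    then obtain k where k: "k \<in> V" "(k \<in> side g) \<noteq> (u \<in> side g)" by blast
    have same: "(x \<in> side f) = (k \<in> side f)" if x: "x \<in> V" "(x \<in> side g) = (k \<in> side g)" for x
    proof -
      have "conn (E - {g}) k x" using side_iff[OF assms(2) k(1) x(1)] x by simp
      then have "conn (E - {f}) k x"
      proof (induction rule: conn_induct)
        case (step y z)
        have y: "y \<in> V" using step.hyps edges_in_V by auto
        have "(y \<in> side g) = (k \<in> side g)" using side_iff[OF assms(2) k(1) y] step.hyps by simp
        then have "{y, z} \<noteq> f" using f k uvg by (auto simp: doubleton_eq_iff)
        then have "conn (E - {f}) y z" using step.hyps by (intro conn_edge) auto
        with step.IH show ?case by (rule conn_trans)
      qed simp
      then show ?thesis using side_iff[OF assms(1) k(1) x(1)] by simp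
    qed
    show ?thesis
      by (rule exI[of _ "k \<notin> side f"], rule exI[of _ "k \<in> side g"]) (use same in blast)
  next
    case False
    then show ?thesis by blast
  qed
qed

lemma side_nonempty:
  assumes "f \<in> E"
  shows "side f \<noteq> {}"
  using edge_ends[OF assms] edge_side_iff[of _ _ f] assms by blast

text \<open>The root lies outside both sides, so the empty quadrant must be one of the other
  three.\<close>

lemma sides_laminar:
  assumes "f \<in> E" "g \<in> E" "f \<noteq> g"
  shows "side f \<inter> side g = {} \<or> side f \<subset> side g \<or> side g \<subset> side f"
proof -
  obtain u v where f: "f = {u, v}" using edge_ends assms(1) by blast
  have "side f \<noteq> side g"
    using edge_side_iff[of u v f] edge_side_iff[of u v g] assms f by auto
  moreover have "side f \<inter> side g = {} \<or> side f \<subseteq> side g \<or> side g \<subseteq> side f"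
    using empty_quadrant[OF assms] root root_notin_side[of f] root_notin_side[of g]
      side_subset[of f] side_subset[of g] by blast
  ultimately show ?thesis by blast
qed

text \<open>A choice of one side per edge, any two chosen sides meeting, singles out a vertex
  (Helly property): a vertex in as many chosen sides as possible lies in all of them, since it
  could be moved across any violated edge without leaving a chosen side.\<close>
lemma oriented_sides_meet:
  assumes meet: "\<And>f g. f \<in> E \<Longrightarrow> g \<in> E \<Longrightarrow>
      \<exists>m\<in>V. (m \<in> side f) = \<sigma> f \<and> (m \<in> side g) = \<sigma> g"
  shows "\<exists>z\<in>V. \<forall>f\<in>E. (z \<in> side f) = \<sigma> f"
proof -
  define N where "N z = {f \<in> E. (z \<in> side f) = \<sigma> f}" for z
  have finN: "finite (N z)" for z using finite_E by (simp add: N_def)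
  obtain z where z: "z \<in> V" "\<And>y. y \<in> V \<Longrightarrow> card (N y) \<le> card (N z)"
  proof -
    have "Max ((\<lambda>y. card (N y)) ` V) \<in> (\<lambda>y. card (N y)) ` V"
      using finite_V root by (intro Max_in) auto
    then obtain z where "z \<in> V" "Max ((\<lambda>y. card (N y)) ` V) = card (N z)" by auto
    moreover have "card (N y) \<le> Max ((\<lambda>y. card (N y)) ` V)" if "y \<in> V" for y
      using finite_V that by simp
    ultimately show ?thesis using that[of z] by simp
  qed
  have "(z \<in> side f) = \<sigma> f" if f: "f \<in> E" for f
  proof (rule ccontr)
    assume nf: "(z \<in> side f) \<noteq> \<sigma> f"
    \<comment> \<open>The violated edge \<open>f\<close> is crossed from \<open>p\<close> to
      \<open>q\<close>; it remains to see that \<open>q\<close> keeps every choice that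
      \<open>z\<close> satisfies.\<close>
    obtain p q where pq: "f = {p, q}" "p \<in> V" "q \<in> V"
      and q: "(q \<in> side f) = \<sigma> f" and p: "(p \<in> side f) \<noteq> \<sigma> f"
    proof -
      obtain u v where "f = {u, v}" "u \<in> V" "v \<in> V" using edge_ends f by blast
      then show ?thesis
        using that[of u v] that[of v u] edge_side_iff[of u v f] f by (auto simp: insert_commute)
    qed
    have "g \<in> N q" if "g \<in> N z" for g
    proof (rule ccontr)
      assume "g \<notin> N q"
      then have g: "g \<in> E" "(z \<in> side g) = \<sigma> g" "(q \<in> side g) \<noteq> \<sigma> g" "g \<noteq> f"
        using that nf by (auto simp: N_def)
      have "(p \<in> side g) \<noteq> \<sigma> g" using edge_side_iff[of p q g] f pq g by auto
      moreover obtain m where "m \<in> V" "(m \<in> side f) = \<sigma> f" "(m \<in> side g) = \<sigma> g"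
        using meet f g by blast
      \<comment> \<open>The vertices \<open>z\<close>, \<open>p\<close>, \<open>q\<close> and
        \<open>m\<close> would occupy all four quadrants of \<open>f\<close> and
        \<open>g\<close>.\<close>
      ultimately show False
        using empty_quadrant[OF f g(1)] g z(1) pq p q nf by metis
    qed
    moreover have "f \<in> N q" "f \<notin> N z" using f q nf by (auto simp: N_def)
    ultimately have "N z \<subset> N q" by blast
    then have "card (N z) < card (N q)" by (rule psubset_card_mono[OF finN])
    then show False using z(2)[OF pq(3)] by simp
  qed
  then show ?thesis using z(1) by blast
qed

end

section \<open>Maximum flows and minimum cuts in trees\<close>

definition cut :: "'v set set \<Rightarrow> ('v set \<Rightarrow> real) \<Rightarrow> 'v set \<Rightarrow> real" where
  "cut E b X = (\<Sum>f\<in>E. if f \<inter> X \<noteq> {} \<and> \<not> f \<subseteq> X then b f else 0)"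

context rooted_tree
begin

text \<open>The cut semimetric of an edge. It is real-valued so that loads are linear in the demands
  and routes can be compared by the triangle inequality.\<close>

definition sep :: "'v set \<Rightarrow> 'v \<Rightarrow> 'v \<Rightarrow> real" where
  "sep f x y = of_bool ((x \<in> side f) \<noteq> (y \<in> side f))"

lemma sep_nonneg [simp]: "0 \<le> sep f x y"
  and sep_self [simp]: "sep f x x = 0"
  and sep_triangle: "sep f x z \<le> sep f x y + sep f y z"
  by (auto simp: sep_def)

text \<open>The path from \<open>a\<close> to \<open>b\<close> traverses the edge from
  \<open>y\<close> to \<open>x\<close>, so its pieces from \<open>a\<close> to \<open>y\<close> and
  from \<open>x\<close> to \<open>b\<close> share no edge. If another edge \<open>g\<close> lay on
  both pieces, then \<open>a\<close>, \<open>y\<close>, \<open>x\<close>, \<open>b\<close> would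
  fill all four quadrants.\<close>

lemma sep_through_edge:
  assumes "{x, y} \<in> E" "g \<in> E" "a \<in> V" "b \<in> V"
    and ab: "sep {x, y} a b = 1" and ay: "sep {x, y} a y = 0"
  shows "sep g a y + sep g x b \<le> sep g a b"
proof (cases "g = {x, y}")
  case True
  then show ?thesis
    using edge_side_iff[OF assms(1,2)] ab ay by (auto simp: sep_def split: if_splits)
next
  case False
  have xy: "x \<in> V" "y \<in> V" using assms(1) edges_in_V by auto
  have "(x \<in> side g) = (y \<in> side g)" "(x \<in> side {x, y}) \<noteq> (y \<in> side {x, y})"
    using edge_side_iff[OF assms(1)] assms(1,2) False by blast+
  moreover have "(a \<in> side {x, y}) = (y \<in> side {x, y})" "(a \<in> side {x, y}) \<noteq> (b \<in> side {x, y})"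
    using ab ay by (auto simp: sep_def)
  ultimately have "\<not> ((a \<in> side g) \<noteq> (y \<in> side g) \<and> (b \<in> side g) \<noteq> (x \<in> side g))"
    using empty_quadrant[OF assms(1,2) False[symmetric]] xy assms(3,4) by metis
  with \<open>(x \<in> side g) = (y \<in> side g)\<close> show ?thesis by (auto simp: sep_def)
qed

text \<open>A flow is recorded by the amount for each source-sink pair, routed on the tree path, so
  that it can later be read as a demand pattern.\<close>

definition flow_load :: "'v set \<Rightarrow> 'v set \<Rightarrow> ('v \<times> 'v \<Rightarrow> real) \<Rightarrow> 'v set \<Rightarrow> real" where
  "flow_load A B D f = (\<Sum>p\<in>A \<times> B. D p * sep f (fst p) (snd p))"

definition flow :: "'v set \<Rightarrow> 'v set \<Rightarrow> ('v set \<Rightarrow> real) \<Rightarrow> ('v \<times> 'v \<Rightarrow> real) \<Rightarrow> bool" where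
  "flow A B b D \<longleftrightarrow> (\<forall>p. 0 \<le> D p) \<and> (\<forall>f\<in>E. flow_load A B D f \<le> b f)"

lemma flow_load_nonneg: "(\<And>p. 0 \<le> D p) \<Longrightarrow> 0 \<le> flow_load A B D f"
  unfolding flow_load_def by (intro sum_nonneg) simp

lemma flow_load_combination:
  "flow_load A B (\<lambda>p. s * D p + t * D' p) f = s * flow_load A B D f + t * flow_load A B D' f"
  by (simp add: flow_load_def sum.distrib sum_distrib_left algebra_simps)

lemma flow_load_add_at:
  assumes "finite A" "finite B" "q \<in> A \<times> B"
  shows "flow_load A B (\<lambda>p. D p + (if p = q then \<delta> else 0)) f
    = flow_load A B D f + \<delta> * sep f (fst q) (snd q)"
proof -
  have "flow_load A B (\<lambda>p. D p + (if p = q then \<delta> else 0)) f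
      = (\<Sum>p\<in>A \<times> B. D p * sep f (fst p) (snd p) + (if p = q then \<delta> * sep f (fst q) (snd q) else 0))"
    unfolding flow_load_def by (intro sum.cong) (auto simp: algebra_simps)
  also have "\<dots> = flow_load A B D f + \<delta> * sep f (fst q) (snd q)"
    using assms by (simp add: sum.distrib flow_load_def)
  finally show ?thesis .
qed

text \<open>Compactness: feasible flows that vanish outside \<open>A \<times> B\<close> form a
  closed subset of a product of compact intervals.\<close>

lemma max_flow_exists:
  assumes "A \<subseteq> V" "B \<subseteq> V" "A \<inter> B = {}" and b: "\<And>f. f \<in> E \<Longrightarrow> 0 \<le> b f"
  obtains D where "flow A B b D" "\<And>D'. flow A B b D' \<Longrightarrow> sum D' (A \<times> B) \<le> sum D (A \<times> B)"
proof -
  have fin: "finite (A \<times> B)" using assms(1,2) finite_V finite_subset by blast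
  \<comment> \<open>The bound \<open>sum b E\<close> excludes no flow: source and sink differ, so
    some edge separates them and its capacity bounds their demand.\<close>
  define I where "I p = (if p \<in> A \<times> B then {0..sum b E} else {0})" for p
  define K where "K = (PiE UNIV I :: ('v \<times> 'v \<Rightarrow> real) set)"
  define S where "S = K \<inter> (\<Inter>f\<in>E. {D. flow_load A B D f \<le> b f})"
  have cont: "continuous_on UNIV (\<lambda>D :: 'v \<times> 'v \<Rightarrow> real. flow_load A B D f)" for f
    unfolding flow_load_def by (intro continuous_intros continuous_on_product_coordinates)
  have "compactin (product_topology (\<lambda>_. euclidean) UNIV) K"
    unfolding K_def by (subst compactin_PiE) (auto simp: I_def)
  then have "compact K" by (simp add: euclidean_product_topology)
  moreover have "closed (\<Inter>f\<in>E. {D :: 'v \<times> 'v \<Rightarrow> real. flow_load A B D f \<le> b f})"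
    by (intro closed_INT ballI closed_Collect_le cont continuous_on_const)
  ultimately have "compact S" unfolding S_def by (rule compact_Int_closed)
  moreover have "(\<lambda>_. 0) \<in> S"
    using b by (auto simp: S_def K_def I_def flow_load_def sum_nonneg)
  moreover have "continuous_on S (\<lambda>D. sum D (A \<times> B))"
    by (intro continuous_on_sum continuous_on_subset[OF continuous_on_product_coordinates]) auto
  ultimately obtain D where D: "D \<in> S" "\<And>D'. D' \<in> S \<Longrightarrow> sum D' (A \<times> B) \<le> sum D (A \<times> B)"
    using continuous_attains_sup[of S "\<lambda>D. sum D (A \<times> B)"] by blast
  have "D p \<ge> 0" for p
  proof -
    have "D p \<in> I p" using D(1) by (auto simp: S_def K_def)
    then show ?thesis by (auto simp: I_def split: if_splits)
  qed
  then have "flow A B b D" using D(1) by (auto simp: S_def flow_def)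
  moreover have "sum D' (A \<times> B) \<le> sum D (A \<times> B)" if D': "flow A B b D'" for D'
  proof -
    define D'' where "D'' p = (if p \<in> A \<times> B then D' p else 0)" for p
    have pos: "0 \<le> D' p" for p using D' unfolding flow_def by blast
    have "D' p \<le> sum b E" if p: "p \<in> A \<times> B" for p
    proof -
      have "fst p \<in> V" "snd p \<in> V" "fst p \<noteq> snd p" using p assms(1-3) by auto
      then obtain f where f: "f \<in> E" "(fst p \<in> side f) \<noteq> (snd p \<in> side f)"
        by (rule separating_edge)
      then have "D' p = D' p * sep f (fst p) (snd p)" by (simp add: sep_def)
      also have "\<dots> \<le> flow_load A B D' f"
        unfolding flow_load_def using fin p pos by (intro member_le_sum) auto
      also have "\<dots> \<le> b f" using D' f by (simp add: flow_def)
      also have "\<dots> \<le> sum b E" using f b finite_E by (intro member_le_sum) auto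
      finally show ?thesis .
    qed
    then have "D'' \<in> K" using pos by (auto simp: K_def I_def D''_def)
    moreover have "flow_load A B D'' f = flow_load A B D' f" for f
      unfolding flow_load_def by (intro sum.cong) (auto simp: D''_def)
    ultimately have "D'' \<in> S" using D' by (auto simp: S_def flow_def)
    moreover have "sum D'' (A \<times> B) = sum D' (A \<times> B)"
      by (intro sum.cong) (auto simp: D''_def)
    ultimately show ?thesis using D(2) by metis
  qed
  ultimately show ?thesis using that by blast
qed

text \<open>A vertex \<^term>\<open>x\<close> counts as reachable in the residual network if a flow of value
  \<^term>\<open>M\<close> leaves room for a positive extra amount sent from the sources to \<^term>\<open>x\<close>. Working with
  the extra amounts \<^term>\<open>h\<close> avoids decomposing edge flows into paths.\<close>
definition augmentable where
  "augmentable A B b M x \<longleftrightarrow> (\<exists>D h. (\<forall>p. 0 \<le> D p) \<and> (\<forall>a. 0 \<le> h a) \<and>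
     sum D (A \<times> B) = M \<and> 0 < sum h A \<and>
     (\<forall>f\<in>E. flow_load A B D f + (\<Sum>a\<in>A. h a * sep f a x) \<le> b f))"

text \<open>Mix \<open>D\<close> with a small share of the augmented \<open>D'\<close>. Off
  \<open>{x, y}\<close> the routes to \<open>x\<close> and to \<open>y\<close> use the same edges,
  so both parts respect the capacities; on \<open>{x, y}\<close> the slack of \<open>D\<close>
  absorbs the share.\<close>

lemma augmentable_slack:
  assumes D: "flow A B b D" and aug: "augmentable A B b (sum D (A \<times> B)) x"
    and xy: "{x, y} \<in> E" and slack: "flow_load A B D {x, y} < b {x, y}"
  shows "augmentable A B b (sum D (A \<times> B)) y"
proof -
  obtain D' h where D': "\<And>p. 0 \<le> D' p" and h: "\<And>a. 0 \<le> h a"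
    and M: "sum D' (A \<times> B) = sum D (A \<times> B)" and hpos: "0 < sum h A"
    and cap: "\<And>f. f \<in> E \<Longrightarrow> flow_load A B D' f + (\<Sum>a\<in>A. h a * sep f a x) \<le> b f"
    using aug unfolding augmentable_def by blast
  define load where "load f = flow_load A B D' f + (\<Sum>a\<in>A. h a * sep f a y)" for f
  define s where "s = b {x, y} - flow_load A B D {x, y}"
  have s: "0 < s" using slack by (simp add: s_def)
  have K: "0 \<le> load {x, y}"
    unfolding load_def using D' h by (intro add_nonneg_nonneg flow_load_nonneg sum_nonneg) auto
  \<comment> \<open>Small enough for \<open>t * load {x, y} \<le> s\<close>; adding \<open>s\<close>
    in the denominator keeps \<open>t\<close> defined and at most 1 even if that load is 0.\<close>
  define t where "t = s / (s + load {x, y})"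
  have t: "0 < t" "t \<le> 1" using s K by (auto simp: t_def)
  have tK: "t * load {x, y} \<le> s" using s K by (simp add: t_def field_simps)
  have Dpos: "0 \<le> D p" for p using D unfolding flow_def by blast
  have Dcap: "flow_load A B D f \<le> b f" if "f \<in> E" for f using D that by (simp add: flow_def)
  have "(1 - t) * flow_load A B D f + t * load f \<le> b f" if f: "f \<in> E" for f
  proof (cases "f = {x, y}")
    case True
    have "0 \<le> t * flow_load A B D f" using t Dpos by (simp add: flow_load_nonneg)
    then show ?thesis using tK True by (simp add: s_def algebra_simps)
  next
    case False
    then have "sep f a y = sep f a x" for a
      using edge_side_iff[OF xy f] by (simp add: sep_def)
    then have "load f \<le> b f" using cap[OF f] by (simp add: load_def)
    then show ?thesis using Dcap[OF f] t
      using convex_bound_le[of "flow_load A B D f" "b f" "load f" "1 - t" t] by simp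
  qed
  moreover have "flow_load A B (\<lambda>p. (1 - t) * D p + t * D' p) f + (\<Sum>a\<in>A. (t * h a) * sep f a y)
      = (1 - t) * flow_load A B D f + t * load f" for f
    by (simp add: flow_load_combination load_def distrib_left sum_distrib_left mult.assoc)
  ultimately have "\<forall>f\<in>E. flow_load A B (\<lambda>p. (1 - t) * D p + t * D' p) f + (\<Sum>a\<in>A. (t * h a) * sep f a y) \<le> b f"
    by simp
  moreover have "0 \<le> (1 - t) * D p + t * D' p" for p using t Dpos D' by simp
  moreover have "(\<Sum>p\<in>A \<times> B. (1 - t) * D p + t * D' p) = sum D (A \<times> B)"
    using M by (simp add: sum.distrib flip: sum_distrib_left) (simp add: algebra_simps)
  moreover have "0 < (\<Sum>a\<in>A. t * h a)" using t hpos by (simp flip: sum_distrib_left)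
  moreover have "0 \<le> t * h a" for a using t h by simp
  ultimately show ?thesis unfolding augmentable_def
    by (intro exI[of _ "\<lambda>p. (1 - t) * D p + t * D' p"] exI[of _ "\<lambda>a. t * h a"]) simp
qed

text \<open>If some \<^term>\<open>a\<close>-\<^term>\<open>c\<close> demand uses the edge from \<^term>\<open>y\<close> to \<^term>\<open>x\<close>, part of it can be
  exchanged: an extra source \<^term>\<open>a'\<close> reaching \<^term>\<open>x\<close> takes over the rest of the route to
  \<^term>\<open>c\<close>, which releases \<^term>\<open>a\<close> at \<^term>\<open>y\<close>.\<close>
lemma augmentable_reverse:
  assumes fin: "finite A" "finite B" and AB: "A \<subseteq> V" "B \<subseteq> V"
    and D: "flow A B b D" and aug: "augmentable A B b (sum D (A \<times> B)) x"
    and xy: "{x, y} \<in> E" and ac: "a \<in> A" "c \<in> B" "0 < D (a, c)"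
    and rev: "sep {x, y} a c = 1" "sep {x, y} a y = 0"
  shows "augmentable A B b (sum D (A \<times> B)) y"
proof -
  obtain D' h where D': "\<And>p. 0 \<le> D' p" and h: "\<And>a. 0 \<le> h a"
    and M: "sum D' (A \<times> B) = sum D (A \<times> B)" and hpos: "0 < sum h A"
    and cap: "\<And>f. f \<in> E \<Longrightarrow> flow_load A B D' f + (\<Sum>a\<in>A. h a * sep f a x) \<le> b f"
    using aug unfolding augmentable_def by blast
  obtain a' where a': "a' \<in> A" "0 < h a'"
    using hpos h by (metis less_le_not_le not_less sum_nonpos)
  define \<delta> where "\<delta> = min (D (a, c)) (h a') / 2"
  have \<delta>: "0 < \<delta>" "\<delta> \<le> D (a, c) / 2" "\<delta> \<le> h a' / 2" using ac a' by (auto simp: \<delta>_def)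
  \<comment> \<open>The positive demand of \<open>(a, c)\<close> belongs to \<open>D\<close>, the
    extra amount of \<open>a'\<close> to \<open>D'\<close>; their average retains half of each,
    which is enough for an exchange of size \<delta>.\<close>
  define D1 where "D1 p = (1/2) * D p + (1/2) * D' p" for p
  define D2 where "D2 p = D1 p + (if p = (a', c) then \<delta> else 0)" for p
  define D3 where "D3 p = D2 p + (if p = (a, c) then - \<delta> else 0)" for p
  have Dpos: "0 \<le> D p" for p using D unfolding flow_def by blast
  have "0 \<le> D3 p" for p
    using \<delta> Dpos[of p] D'[of p] by (auto simp: D3_def D2_def D1_def)
  moreover have "sum D3 (A \<times> B) = sum D (A \<times> B)"
    using M fin ac a' by (simp add: D3_def D2_def D1_def sum.distrib flip: sum_divide_distrib)
  moreover have "flow_load A B D3 f + \<delta> * sep f a y \<le> b f" if f: "f \<in> E" for f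
  proof -
    have "sep f a y + sep f x c \<le> sep f a c"
      using ac AB by (intro sep_through_edge[OF xy f _ _ rev]) auto
    moreover have "sep f a' c \<le> sep f a' x + sep f x c" by (rule sep_triangle)
    ultimately have "sep f a' c - sep f a c + sep f a y \<le> sep f a' x" by simp
    then have "\<delta> * (sep f a' c - sep f a c + sep f a y) \<le> \<delta> * sep f a' x"
      using \<delta> by (intro mult_left_mono) auto
    also have "\<dots> \<le> h a' / 2 * sep f a' x" using \<delta> by (intro mult_right_mono) auto
    also have "\<dots> = (1/2) * (h a' * sep f a' x)" by simp
    also have "\<dots> \<le> (1/2) * (\<Sum>a\<in>A. h a * sep f a x)"
      using fin a' h by (intro mult_left_mono member_le_sum) auto
    finally have *: "\<delta> * (sep f a' c - sep f a c + sep f a y) \<le> (1/2) * (\<Sum>a\<in>A. h a * sep f a x)" .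
    have "flow_load A B D3 f = flow_load A B D1 f + \<delta> * sep f a' c - \<delta> * sep f a c"
      unfolding D3_def[abs_def] D2_def[abs_def] using fin ac a' by (simp add: flow_load_add_at)
    also have "flow_load A B D1 f = (1/2) * flow_load A B D f + (1/2) * flow_load A B D' f"
      unfolding D1_def[abs_def] by (rule flow_load_combination)
    finally show ?thesis
      using * cap[OF f] D f by (fastforce simp: algebra_simps flow_def)
  qed
  then have "\<forall>f\<in>E. flow_load A B D3 f + (\<Sum>i\<in>A. (if i = a then \<delta> else 0) * sep f i y) \<le> b f"
    using fin ac by (simp add: if_distrib[of "\<lambda>s. s * _"] cong: if_cong)
  moreover have "0 < (\<Sum>i\<in>A. if i = a then \<delta> else 0)" using fin ac \<delta> by simp
  moreover have "0 \<le> (if i = a then \<delta> else 0)" for i using \<delta> by simp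
  ultimately show ?thesis unfolding augmentable_def
    by (intro exI[of _ D3] exI[of _ "\<lambda>i. if i = a then \<delta> else 0"]) simp
qed

text \<open>Extra amounts that reach a sink \<open>x\<close> can be added as demands of the pairs
  \<open>(a, x)\<close>, which would raise the flow value above \<open>M\<close>.\<close>

lemma not_augmentable_sink:
  assumes fin: "finite A" "finite B" and "x \<in> B"
    and max: "\<And>D'. flow A B b D' \<Longrightarrow> sum D' (A \<times> B) \<le> M"
  shows "\<not> augmentable A B b M x"
proof
  assume "augmentable A B b M x"
  then obtain D h where D: "\<And>p. 0 \<le> D p" and h: "\<And>a. 0 \<le> h a"
    and M: "sum D (A \<times> B) = M" and hpos: "0 < sum h A"
    and cap: "\<And>f. f \<in> E \<Longrightarrow> flow_load A B D f + (\<Sum>a\<in>A. h a * sep f a x) \<le> b f"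
    unfolding augmentable_def by blast
  define D' where "D' p = D p + (if snd p = x then h (fst p) else 0)" for p
  have *: "(\<Sum>p\<in>A \<times> B. if snd p = x then k (fst p) else 0) = sum k A" for k :: "'v \<Rightarrow> real"
    using fin assms(3) by (simp add: sum.cartesian_product' )
  have "flow_load A B D' f = flow_load A B D f
      + (\<Sum>p\<in>A \<times> B. if snd p = x then h (fst p) * sep f (fst p) x else 0)" for f
    unfolding flow_load_def D'_def sum.distrib[symmetric]
    by (intro sum.cong) (auto simp: algebra_simps)
  then have "flow_load A B D' f \<le> b f" if "f \<in> E" for f
    using cap[OF that] *[of "\<lambda>a. h a * sep f a x"] by simp
  moreover have "0 \<le> D' p" for p using D h by (simp add: D'_def)
  ultimately have "flow A B b D'" by (simp add: flow_def)
  moreover have "sum D' (A \<times> B) = M + sum h A"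
    using M * by (simp add: D'_def sum.distrib)
  ultimately show False using max hpos by force
qed

text \<open>Max-flow min-cut: at a maximum flow the augmentable vertices form a cut whose edges are
  saturated and never crossed backwards.\<close>
lemma flow_ge_some_cut:
  assumes AB: "A \<subseteq> V" "B \<subseteq> V" "A \<inter> B = {}" and b: "\<And>f. f \<in> E \<Longrightarrow> 0 \<le> b f"
  obtains D R where "flow A B b D" "R \<subseteq> V" "A \<subseteq> R" "R \<inter> B = {}" "cut E b R \<le> sum D (A \<times> B)"
proof -
  have fin: "finite A" "finite B" using AB finite_V finite_subset by blast+
  obtain D where D: "flow A B b D" and max: "\<And>D'. flow A B b D' \<Longrightarrow> sum D' (A \<times> B) \<le> sum D (A \<times> B)"
    using max_flow_exists[of A B b] AB b by metis
  have Dpos: "0 \<le> D p" for p using D unfolding flow_def by blast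
  define R where "R = {x \<in> V. augmentable A B b (sum D (A \<times> B)) x}"
  define crosses where "crosses f \<longleftrightarrow> f \<inter> R \<noteq> {} \<and> \<not> f \<subseteq> R" for f
  have "R \<inter> B = {}" using not_augmentable_sink[OF fin _ max] by (auto simp: R_def)
  moreover have "A \<subseteq> R"
  proof
    fix a assume a: "a \<in> A"
    have "flow_load A B D f + (\<Sum>i\<in>A. (if i = a then 1 else 0) * sep f i a) = flow_load A B D f" for f
      using fin a by (simp add: if_distrib[of "\<lambda>s. s * _"] cong: if_cong)
    moreover have "0 < (\<Sum>i\<in>A. if i = a then 1 else 0 :: real)" using fin a by simp
    ultimately have "augmentable A B b (sum D (A \<times> B)) a"
      unfolding augmentable_def using D
      by (intro exI[of _ D] exI[of _ "\<lambda>i. if i = a then 1 else 0"]) (simp add: flow_def)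
    then show "a \<in> R" using a AB by (auto simp: R_def)
  qed
  moreover have "cut E b R \<le> sum D (A \<times> B)"
  proof -
    have out: "flow_load A B D {x, y} = b {x, y}"
        "\<And>p. p \<in> A \<times> B \<Longrightarrow> 0 < D p \<Longrightarrow> sep {x, y} (fst p) (snd p) = 1 \<Longrightarrow> sep {x, y} (fst p) y = 0 \<Longrightarrow> False"
      if xy: "{x, y} \<in> E" "x \<in> R" "y \<notin> R" for x y
    proof -
      have x: "augmentable A B b (sum D (A \<times> B)) x" and y: "\<not> augmentable A B b (sum D (A \<times> B)) y"
        using xy edges_in_V by (auto simp: R_def)
      show "flow_load A B D {x, y} = b {x, y}"
        using augmentable_slack[OF D x xy(1)] y D xy(1) by (fastforce simp: flow_def)
      show False if "p \<in> A \<times> B" "0 < D p" "sep {x, y} (fst p) (snd p) = 1" "sep {x, y} (fst p) y = 0" for p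
        using augmentable_reverse[OF fin AB(1,2) D x xy(1), of "fst p" "snd p"] that y by auto
    qed
    have load: "flow_load A B D f = b f" if f: "f \<in> E" "crosses f" for f
    proof -
      obtain u v where "f = {u, v}" using edge_ends f(1) by blast
      then show ?thesis using f out(1)[of u v] out(1)[of v u]
        by (auto simp: crosses_def insert_commute)
    qed
    \<comment> \<open>A route with positive demand crosses the boundary of \<open>R\<close> at most
      once, so each unit of flow pays for the cut at most once.\<close>
    have once: "(\<Sum>f\<in>E. if crosses f then sep f (fst p) (snd p) else 0) \<le> 1"
      if p: "p \<in> A \<times> B" "0 < D p" for p
    proof -
      define q where "q = tree_path V E (fst p) (snd p)"
      have pV: "fst p \<in> V" "snd p \<in> V" using p AB by auto
      have q: "spath V E q (fst p) (snd p)" unfolding q_def by (rule tree_path_spath[OF pV])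
      have qE: "{q ! k, q ! Suc k} \<in> E" and qV: "q ! k \<in> V" "q ! Suc k \<in> V"
        and qsep: "sep {q ! k, q ! Suc k} (fst p) (snd p) = 1"
        and qpre: "sep {q ! k, q ! Suc k} (fst p) (q ! k) = 0" if k: "k < length q - 1" for k
      proof -
        let ?f = "{q ! k, q ! Suc k}"
        show V: "q ! k \<in> V" "q ! Suc k \<in> V" and E: "?f \<in> E"
          using q k by (auto simp: spath_def walk_def)
        have "?f \<in> path_edges q" using k by (auto simp: path_edges_def)
        then show "sep ?f (fst p) (snd p) = 1"
          using tree_path_side_iff[OF E pV] by (simp add: q_def sep_def)
        \<comment> \<open>The part of the path before its \<open>k\<close>-th edge avoids that edge
          and so connects \<open>fst p\<close> to \<open>q ! k\<close> on the same side.\<close>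
        define pre where "pre = take (Suc k) q"
        have "?f \<notin> path_edges pre"
        proof
          assume "?f \<in> path_edges pre"
          then obtain i where i: "i < k" "?f = {q ! i, q ! Suc i}"
            using k by (auto simp: path_edges_def pre_def)
          then have "q ! Suc k = q ! i \<or> q ! Suc k = q ! Suc i" by (auto simp: doubleton_eq_iff)
          moreover have "distinct q" "i < length q" "Suc i < length q" "Suc k < length q"
            using q k i by (auto simp: spath_iff)
          ultimately show False using i(1) nth_eq_iff_index_eq by fastforce
        qed
        moreover have "path_edges pre \<subseteq> E"
          using path_edges_mono_append(1)[of pre "drop (Suc k) q"] q by (auto simp: pre_def spath_iff)
        moreover have "pre \<noteq> []" "hd pre = fst p" "last pre = q ! k"
          using k q by (auto simp: pre_def spath_iff hd_take last_conv_nth)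
        ultimately have "conn (E - {?f}) (fst p) (q ! k)"
          using conn_mono[OF conn_path_edges[of pre], of "E - {?f}"] by auto
        then show "sep ?f (fst p) (q ! k) = 0"
          using side_iff[OF E pV(1) V(1)] by (simp add: sep_def)
      qed
      \<comment> \<open>Once outside \<open>R\<close> the route stays outside: a return would
        traverse an edge leaving \<open>R\<close> backwards.\<close>
      have stay: "q ! Suc k \<notin> R" if k: "k < length q - 1" "q ! k \<notin> R" for k
        using out(2)[of "q ! Suc k" "q ! k" p] qE[OF k(1)] qsep[OF k(1)] qpre[OF k(1)] p k(2)
        by (auto simp: insert_commute)
      have stays: "q ! j \<notin> R" if "i \<le> j" "j \<le> length q - 1" "q ! i \<notin> R" for i j
        using that(1,2)
      proof (induction j rule: dec_induct)
        case (step n)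
        then show ?case using stay[of n] by simp
      qed (use that in simp)
      have cross_iff: "crosses {q ! k, q ! Suc k} \<longleftrightarrow> q ! k \<in> R \<and> q ! Suc k \<notin> R"
        if "k < length q - 1" for k
        using stay[OF that] by (auto simp: crosses_def)
      have unique: "i = j" if "i < length q - 1" "j < length q - 1"
        "crosses {q ! i, q ! Suc i}" "crosses {q ! j, q ! Suc j}" for i j
        using that cross_iff[of i] cross_iff[of j] stays[of "Suc i" j] stays[of "Suc j" i]
        by (cases i j rule: linorder_cases) auto
      define C where "C = {f \<in> path_edges q. crosses f}"
      have "f = g" if "f \<in> C" "g \<in> C" for f g
        using that unique by (auto simp: C_def path_edges_def)
      then have "card C \<le> 1"
        by (metis card.infinite card_le_Suc0_iff_eq One_nat_def le0)
      have "(\<Sum>f\<in>E. if crosses f then sep f (fst p) (snd p) else 0) = (\<Sum>f\<in>E. if f \<in> C then 1 else 0)"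
        using tree_path_side_iff[OF _ pV] by (intro sum.cong) (auto simp: C_def q_def sep_def)
      also have "\<dots> = real (card (E \<inter> C))" using finite_E by (simp add: sum.If_cases)
      also have "\<dots> \<le> real (card C)"
        by (simp add: C_def card_mono)
      finally show ?thesis using \<open>card C \<le> 1\<close> by linarith
    qed
    \<comment> \<open>Double counting: the cut edges are saturated, so their capacities are loads,
      which are then summed by source-sink pair.\<close>
    have "cut E b R = (\<Sum>f\<in>E. if crosses f then flow_load A B D f else 0)"
      unfolding cut_def using load by (intro sum.cong) (auto simp: crosses_def)
    also have "\<dots> = (\<Sum>f\<in>E. \<Sum>p\<in>A \<times> B. D p * (if crosses f then sep f (fst p) (snd p) else 0))"
      by (intro sum.cong) (auto simp: flow_load_def)
    also have "\<dots> = (\<Sum>p\<in>A \<times> B. D p * (\<Sum>f\<in>E. if crosses f then sep f (fst p) (snd p) else 0))"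
      by (subst sum.swap) (simp add: sum_distrib_left)
    also have "\<dots> \<le> (\<Sum>p\<in>A \<times> B. D p)"
    proof (rule sum_mono)
      fix p assume p: "p \<in> A \<times> B"
      show "D p * (\<Sum>f\<in>E. if crosses f then sep f (fst p) (snd p) else 0) \<le> D p"
        using once[OF p] Dpos[of p] mult_left_le[of _ "D p"] by (cases "D p = 0") auto
    qed
    finally show ?thesis .
  qed
  moreover have "R \<subseteq> V" by (auto simp: R_def)
  ultimately show ?thesis using that D by blast
qed

end

section \<open>Uncrossing of minimum cuts\<close>

lemma cut_uncross:
  assumes edges: "\<forall>f\<in>E. \<exists>u v. f = {u, v}" and b: "\<forall>f\<in>E. 0 \<le> b f"
  shows "cut E b (X \<inter> Y) + cut E b (X \<union> Y) \<le> cut E b X + cut E b Y"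
    and "cut E b (X - Y) + cut E b (Y - X) \<le> cut E b X + cut E b Y"
proof -
  let ?w = "\<lambda>X f. if f \<inter> X \<noteq> {} \<and> \<not> f \<subseteq> X then b f else 0"
  \<comment> \<open>Submodularity and posimodularity of the cut function hold already for each edge,
    by cases on where its two ends lie.\<close>
  have "?w (X \<inter> Y) f + ?w (X \<union> Y) f \<le> ?w X f + ?w Y f"
    "?w (X - Y) f + ?w (Y - X) f \<le> ?w X f + ?w Y f" if f: "f \<in> E" for f
  proof -
    obtain u v where "f = {u, v}" using edges f by blast
    then show "?w (X \<inter> Y) f + ?w (X \<union> Y) f \<le> ?w X f + ?w Y f"
      "?w (X - Y) f + ?w (Y - X) f \<le> ?w X f + ?w Y f"
      using b f by (cases "u \<in> X"; cases "v \<in> X"; cases "u \<in> Y"; cases "v \<in> Y"; simp)+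
  qed
  then show "cut E b (X \<inter> Y) + cut E b (X \<union> Y) \<le> cut E b X + cut E b Y"
    "cut E b (X - Y) + cut E b (Y - X) \<le> cut E b X + cut E b Y"
    unfolding cut_def sum.distrib[symmetric] by (simp_all only: sum_mono)
qed

text \<open>Inclusion-minimality breaks ties among minimum cuts with the same trace \<open>S\<close>
  on \<open>U\<close>; without it, minimum cuts for nested traces need not be nested.\<close>

definition minimal_mincut ::
  "'v set \<Rightarrow> 'v set set \<Rightarrow> ('v set \<Rightarrow> real) \<Rightarrow> 'v set \<Rightarrow> 'v set \<Rightarrow> 'v set \<Rightarrow> bool" where
  "minimal_mincut V E b U S X \<longleftrightarrow> X \<subseteq> V \<and> X \<inter> U = S \<and>
     (\<forall>Y. Y \<subseteq> V \<and> Y \<inter> U = S \<longrightarrow> cut E b X \<le> cut E b Y) \<and>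
     (\<forall>Y. Y \<subseteq> X \<and> Y \<inter> U = S \<and> cut E b Y \<le> cut E b X \<longrightarrow> Y = X)"

lemma minimal_mincutD:
  assumes "minimal_mincut V E b U S X"
  shows "X \<subseteq> V" "X \<inter> U = S"
    "\<And>Y. Y \<subseteq> V \<Longrightarrow> Y \<inter> U = S \<Longrightarrow> cut E b X \<le> cut E b Y"
    "\<And>Y. Y \<subseteq> X \<Longrightarrow> Y \<inter> U = S \<Longrightarrow> cut E b Y \<le> cut E b X \<Longrightarrow> Y = X"
  using assms by (simp_all add: minimal_mincut_def)

lemma minimal_mincut_exists:
  assumes "finite V" "S \<subseteq> U" "S \<subseteq> V"
  shows "\<exists>X. minimal_mincut V E b U S X"
proof -
  define F where "F = {X. X \<subseteq> V \<and> X \<inter> U = S}"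
  have "finite F" "S \<in> F" using assms by (auto simp: F_def)
  then obtain X0 where X0: "X0 \<in> F" "\<And>Y. Y \<in> F \<Longrightarrow> cut E b X0 \<le> cut E b Y"
    using arg_min_if_finite[of F "cut E b"] by (metis empty_iff linorder_not_less)
  define F' where "F' = {X \<in> F. cut E b X \<le> cut E b X0}"
  have "finite F'" "X0 \<in> F'" using \<open>finite F\<close> X0 by (auto simp: F'_def)
  then obtain X where X: "X \<in> F'" "\<And>Y. Y \<in> F' \<Longrightarrow> Y \<subseteq> X \<Longrightarrow> X = Y"
    using finite_has_minimal2[of F' X0] by blast
  have "cut E b X \<le> cut E b Y" if "Y \<in> F" for Y
    using X(1) X0(2)[OF that] by (simp add: F'_def)
  moreover have "Y = X" if "Y \<subseteq> X" "Y \<inter> U = S" "cut E b Y \<le> cut E b X" for Y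
    using X(2)[of Y] X(1) that by (auto simp: F'_def F_def)
  moreover have "X \<subseteq> V" "X \<inter> U = S" using X(1) by (auto simp: F'_def F_def)
  ultimately have "minimal_mincut V E b U S X" by (simp add: minimal_mincut_def F_def)
  then show ?thesis ..
qed

context
  fixes V U :: "'v set" and E :: "'v set set" and b :: "'v set \<Rightarrow> real"
  assumes edges: "\<forall>f\<in>E. \<exists>u v. f = {u, v}" and b: "\<forall>f\<in>E. 0 \<le> b f"
begin

text \<open>The union competes with \<open>Y\<close>, so by submodularity the intersection costs no
  more than \<open>X\<close>, and minimality of \<open>X\<close> forces them to be equal.\<close>

lemma minimal_mincut_mono:
  assumes X: "minimal_mincut V E b U S X" and Y: "minimal_mincut V E b U S' Y" and "S \<subseteq> S'"
  shows "X \<subseteq> Y"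
proof -
  have "X \<union> Y \<subseteq> V" "(X \<union> Y) \<inter> U = S'" and XY: "(X \<inter> Y) \<inter> U = S"
    using minimal_mincutD(1,2)[OF X] minimal_mincutD(1,2)[OF Y] assms(3) by blast+
  then have "cut E b Y \<le> cut E b (X \<union> Y)" by (intro minimal_mincutD(3)[OF Y])
  then have "cut E b (X \<inter> Y) \<le> cut E b X" using cut_uncross(1)[OF edges b, of X Y] by linarith
  then have "X \<inter> Y = X" using XY by (intro minimal_mincutD(4)[OF X]) auto
  then show ?thesis by blast
qed

text \<open>The same argument with posimodularity: \<open>Y - X\<close> competes with
  \<open>Y\<close>, so \<open>X - Y\<close> costs no more than \<open>X\<close>.\<close>

lemma minimal_mincut_disjoint:
  assumes X: "minimal_mincut V E b U S X" and Y: "minimal_mincut V E b U S' Y" and "S \<inter> S' = {}"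
  shows "X \<inter> Y = {}"
proof -
  have "Y - X \<subseteq> V" "(Y - X) \<inter> U = S'" and XY: "(X - Y) \<inter> U = S"
    using minimal_mincutD(1,2)[OF X] minimal_mincutD(1,2)[OF Y] assms(3) by blast+
  then have "cut E b Y \<le> cut E b (Y - X)" by (intro minimal_mincutD(3)[OF Y])
  then have "cut E b (X - Y) \<le> cut E b X" using cut_uncross(2)[OF edges b, of X Y] by linarith
  then have "X - Y = X" using XY by (intro minimal_mincutD(4)[OF X]) auto
  then show ?thesis by blast
qed

end

section \<open>Hub trees and tree demands\<close>

locale terminal_tree = rooted_tree VT ET r
  for VT :: "('a + nat) set" and ET r +
  fixes W :: "'a set"
  assumes terminals: "Inl ` W \<subseteq> VT"
begin

lemma finite_W: "finite W"
  using finite_subset[OF terminals finite_V] by (simp add: finite_image_iff)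

lemma finite_tpairs: "finite (tpairs W)"
  by (rule finite_subset[of _ "Pow W"]) (use finite_W in \<open>auto simp: tpairs_def\<close>)

text \<open>The side criterion is symmetric in \<open>i\<close> and \<open>j\<close>, so it does not
  matter in which order \<open>on_tpath\<close> names the ends of the pair.\<close>

lemma on_tpath_iff:
  assumes "i \<in> W" "j \<in> W" "f \<in> ET"
  shows "on_tpath VT ET {i, j} f \<longleftrightarrow> (Inl i \<in> side f) \<noteq> (Inl j \<in> side f)"
proof -
  have "Inl i \<in> VT" "Inl j \<in> VT" using assms terminals by auto
  then show ?thesis
    using tree_path_side_iff[OF assms(3)] unfolding on_tpath_def by (auto simp: doubleton_eq_iff)
qed

lemma UTb_bounded:
  assumes D: "D \<in> UTb W VT ET b" and b: "\<And>f. f \<in> ET \<Longrightarrow> 0 \<le> b f"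
  shows "D p \<le> sum b ET"
proof (cases "p \<in> tpairs W")
  case True
  then obtain i j where p: "p = {i, j}" "i \<in> W" "j \<in> W" "i \<noteq> j" by (auto simp: tpairs_def)
  then have "Inl i \<in> VT" "Inl j \<in> VT" "Inl i \<noteq> (Inl j :: 'a + nat)" using terminals by auto
  then obtain f where f: "f \<in> ET" "(Inl i \<in> side f) \<noteq> (Inl j \<in> side f)" by (rule separating_edge)
  then have "p \<in> {p \<in> tpairs W. on_tpath VT ET p f}" using True on_tpath_iff p by simp
  then have "D p \<le> load W VT ET D f"
    unfolding load_def using D finite_tpairs by (intro member_le_sum) (auto simp: UTb_def)
  also have "\<dots> \<le> b f" using D f by (simp add: UTb_def)
  also have "\<dots> \<le> sum b ET" using f b finite_E by (intro member_le_sum) auto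
  finally show ?thesis .
next
  case False
  then show ?thesis using D b by (simp add: UTb_def sum_nonneg)
qed

lemma zero_in_UTb: "(\<And>f. f \<in> ET \<Longrightarrow> 0 \<le> b f) \<Longrightarrow> (\<lambda>_. 0) \<in> UTb W VT ET b"
  by (auto simp: UTb_def load_def)

text \<open>The supremum in \<open>beta\<close> is over a bounded set for any second tree, since
  demands in the universe are bounded and there are finitely many pairs.\<close>

lemma load_le_beta:
  assumes D: "D \<in> UTb W VT ET b" and b: "\<And>f. f \<in> ET \<Longrightarrow> 0 \<le> b f"
  shows "load W VT' ET' D f \<le> beta (UTb W VT ET b) W VT' ET' f"
  unfolding beta_def
proof (rule cSup_upper)
  have "load W VT' ET' D' f \<le> (\<Sum>p\<in>tpairs W. sum b ET)" if D': "D' \<in> UTb W VT ET b" for D'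
  proof -
    have "load W VT' ET' D' f \<le> sum D' (tpairs W)"
      unfolding load_def using D' finite_tpairs by (intro sum_mono2) (auto simp: UTb_def)
    also have "\<dots> \<le> (\<Sum>p\<in>tpairs W. sum b ET)" by (intro sum_mono UTb_bounded[OF D' b])
    finally show ?thesis .
  qed
  then show "bdd_above ((\<lambda>D. load W VT' ET' D f) ` UTb W VT ET b)" by (auto intro!: bdd_aboveI)
qed (use D in auto)

lemma beta_nonneg:
  assumes "\<And>f. f \<in> ET \<Longrightarrow> 0 \<le> b f"
  shows "0 \<le> beta (UTb W VT ET b) W VT' ET' f"
proof -
  have "(\<lambda>_. 0) \<in> UTb W VT ET b" by (rule zero_in_UTb) (rule assms)
  then have "load W VT' ET' (\<lambda>_. 0) f \<le> beta (UTb W VT ET b) W VT' ET' f"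
    by (rule load_le_beta) (rule assms)
  then show ?thesis by (simp add: load_def)
qed

lemma beta_le_capacity:
  assumes "\<And>f. f \<in> ET \<Longrightarrow> 0 \<le> b f" "f \<in> ET"
  shows "beta (UTb W VT ET b) W VT ET f \<le> b f"
  unfolding beta_def
proof (rule cSup_least)
  have "(\<lambda>_. 0) \<in> UTb W VT ET b" by (rule zero_in_UTb) (rule assms(1))
  then show "(\<lambda>D. load W VT ET D f) ` UTb W VT ET b \<noteq> {}" by (metis empty_iff image_is_empty)
qed (use assms(2) in \<open>auto simp: UTb_def\<close>)

text \<open>Reads a source-sink flow as a demand pattern on unordered pairs: after swapping the
  sums, \<open>(i, j)\<close> contributes to the single pair \<open>{i, j}\<close>.\<close>

lemma load_of_pairs:
  assumes AB: "A \<subseteq> W" "B \<subseteq> W" "A \<inter> B = {}" and f: "f \<in> ET"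
  shows "load W VT ET (\<lambda>p. \<Sum>(i, j)\<in>A \<times> B. if p = {i, j} then d (Inl i, Inl j) else 0) f
    = flow_load (Inl ` A) (Inl ` B) d f"
proof -
  have "load W VT ET (\<lambda>p. \<Sum>(i, j)\<in>A \<times> B. if p = {i, j} then d (Inl i, Inl j) else 0) f
      = (\<Sum>(i, j)\<in>A \<times> B. \<Sum>p\<in>{p \<in> tpairs W. on_tpath VT ET p f}. if p = {i, j} then d (Inl i, Inl j) else 0)"
    unfolding load_def by (subst sum.swap) (simp add: case_prod_beta)
  also have "\<dots> = (\<Sum>(i, j)\<in>A \<times> B. d (Inl i, Inl j) * sep f (Inl i) (Inl j))"
  proof (intro sum.cong refl, clarify)
    fix i j assume ij: "i \<in> A" "j \<in> B"
    then have "i \<in> W" "j \<in> W" "i \<noteq> j" using AB by auto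
    then have "{i, j} \<in> tpairs W" unfolding tpairs_def by blast
    then show "(\<Sum>p\<in>{p \<in> tpairs W. on_tpath VT ET p f}. if p = {i, j} then d (Inl i, Inl j) else 0)
        = d (Inl i, Inl j) * sep f (Inl i) (Inl j)"
      using on_tpath_iff[of i j f] ij AB f finite_tpairs by (auto simp: sep_def)
  qed
  also have "\<dots> = flow_load (Inl ` A) (Inl ` B) d f"
  proof -
    have image: "Inl ` A \<times> Inl ` B = (map_prod Inl Inl :: _ \<Rightarrow> ('a + nat) \<times> ('a + nat)) ` (A \<times> B)" by auto
    have inj: "inj_on (map_prod Inl Inl :: _ \<Rightarrow> ('a + nat) \<times> ('a + nat)) (A \<times> B)"
      by (auto simp: inj_on_def)
    show ?thesis
      unfolding flow_load_def image sum.reindex[OF inj] by (simp add: case_prod_beta map_prod_def)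
  qed
  finally show ?thesis .
qed

end

text \<open>\<open>T\<close> carries the capacities that define the universe; \<open>H\<close> is
  the competing hub tree.\<close>

locale hub_tree_pair =
  T: terminal_tree VT ET r W + H: terminal_tree VT' ET' r' W
  for VT :: "('a + nat) set" and ET r and VT' :: "('a + nat) set" and ET' r' and W :: "'a set" +
  fixes b :: "('a + nat) set \<Rightarrow> real"
  assumes b_nonneg: "\<And>f. f \<in> ET \<Longrightarrow> 0 \<le> b f"
begin

abbreviation U where "U \<equiv> UTb W VT ET b"

abbreviation mincut where
  "mincut f \<equiv> minimal_mincut VT ET b (Inl ` W) (H.side f \<inter> Inl ` W)"

text \<open>Take the two terminal classes of \<open>f\<close> as sources and sinks in
  \<open>T\<close>. A maximum flow is a demand pattern of the universe, and in \<open>T'\<close> all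
  of its demand crosses \<open>f\<close>.\<close>

lemma mincut_le_beta:
  assumes f: "f \<in> ET'" and X: "mincut f X"
  shows "cut ET b X \<le> beta U W VT' ET' f"
proof -
  define A where "A = {i \<in> W. Inl i \<in> H.side f}"
  define B where "B = {i \<in> W. Inl i \<notin> H.side f}"
  have AB: "A \<subseteq> W" "B \<subseteq> W" "A \<inter> B = {}" by (auto simp: A_def B_def)
  have "Inl ` A \<subseteq> VT" "Inl ` B \<subseteq> VT" "Inl ` A \<inter> Inl ` B = {}"
    using AB T.terminals by blast+
  then obtain d R where d: "T.flow (Inl ` A) (Inl ` B) b d" and R: "R \<subseteq> VT" "Inl ` A \<subseteq> R" "R \<inter> Inl ` B = {}"
    and le: "cut ET b R \<le> sum d (Inl ` A \<times> Inl ` B)"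
    using T.flow_ge_some_cut[of "Inl ` A" "Inl ` B" b] b_nonneg by metis
  define D where "D p = (\<Sum>(i, j)\<in>A \<times> B. if p = {i, j} then d (Inl i, Inl j) else 0)" for p
  have d0: "0 \<le> d p" for p using d unfolding T.flow_def by blast
  have "D p = 0" if "p \<notin> tpairs W" for p
  proof -
    have "p \<noteq> {i, j}" if "i \<in> A" "j \<in> B" for i j
    proof -
      have "i \<in> W" "j \<in> W" "i \<noteq> j" using AB that by auto
      then show ?thesis using \<open>p \<notin> tpairs W\<close> unfolding tpairs_def by blast
    qed
    then show ?thesis unfolding D_def by (intro sum.neutral) auto
  qed
  moreover have "0 \<le> D p" for p
    unfolding D_def using d0 by (intro sum_nonneg) (simp add: case_prod_beta)
  moreover have "load W VT ET D g \<le> b g" if "g \<in> ET" for g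
    using T.load_of_pairs[OF AB that, of d] d that by (simp add: D_def[abs_def] T.flow_def)
  ultimately have D: "D \<in> U" by (auto simp: UTb_def)
  \<comment> \<open>\<open>R\<close> splits the terminals as \<open>f\<close> does, so it competes
    with \<open>X\<close>.\<close>
  have "R \<inter> Inl ` W = H.side f \<inter> Inl ` W" using R by (auto simp: A_def B_def)
  then have "cut ET b X \<le> cut ET b R" using R(1) by (intro minimal_mincutD(3)[OF X])
  also note le
  also have "sum d (Inl ` A \<times> Inl ` B) = H.flow_load (Inl ` A) (Inl ` B) d f"
    unfolding H.flow_load_def by (intro sum.cong) (auto simp: A_def B_def H.sep_def)
  also have "\<dots> = load W VT' ET' D f"
    using H.load_of_pairs[OF AB f, of d] by (simp add: D_def[abs_def])
  also have "\<dots> \<le> beta U W VT' ET' f" by (rule T.load_le_beta[OF D b_nonneg])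
  finally show ?thesis .
qed

text \<open>Minimal minimum cuts inherit the laminar structure of the sides of \<^term>\<open>VT'\<close>, so they are
  the preimages of these sides under a single map \<^term>\<open>\<psi>\<close>.\<close>
lemma mincut_map:
  assumes X: "\<And>f. f \<in> ET' \<Longrightarrow> mincut f (X f)"
  obtains \<psi> where "\<And>v. v \<in> VT \<Longrightarrow> \<psi> v \<in> VT'" "\<And>i. i \<in> W \<Longrightarrow> \<psi> (Inl i) = Inl i"
    "\<And>v f. v \<in> VT \<Longrightarrow> f \<in> ET' \<Longrightarrow> \<psi> v \<in> H.side f \<longleftrightarrow> v \<in> X f"
proof -
  have edges: "\<forall>f\<in>ET. \<exists>u v. f = {u, v}" and b: "\<forall>f\<in>ET. 0 \<le> b f"
    using T.edge_ends b_nonneg by blast+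
  note mono = minimal_mincut_mono[OF edges b X X]
  note disj = minimal_mincut_disjoint[OF edges b X X]
  have meet: "\<exists>m\<in>VT'. (m \<in> H.side f) = (v \<in> X f) \<and> (m \<in> H.side g) = (v \<in> X g)"
    if fg: "f \<in> ET'" "g \<in> ET'" for v f g
  proof -
    \<comment> \<open>The root \<open>r'\<close> lies outside both sides and any vertex of a
      nonempty side witnesses membership; the one impossible combination is excluded because the
      cuts are disjoint or nested like the sides.\<close>
    have r: "r' \<in> VT'" "r' \<notin> H.side f" "r' \<notin> H.side g"
      using H.root H.root_notin_side by auto
    have sub: "H.side f \<subseteq> VT'" "H.side g \<subseteq> VT'" using H.side_subset by auto
    have ne: "H.side f \<noteq> {}" "H.side g \<noteq> {}" using H.side_nonempty fg by auto
    consider "f = g" | "H.side f \<inter> H.side g = {}" | "H.side f \<subset> H.side g" | "H.side g \<subset> H.side f"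
      using H.sides_laminar[OF fg] by blast
    then show ?thesis
    proof cases
      case 1
      then show ?thesis using r sub ne by blast
    next
      case 2
      then have "X f \<inter> X g = {}" using disj[OF fg] by blast
      then show ?thesis using 2 r sub ne by blast
    next
      case 3
      then have "X f \<subseteq> X g" using mono[OF fg] by blast
      moreover obtain m where "m \<in> H.side g" "m \<notin> H.side f" using 3 by blast
      ultimately show ?thesis
        using 3 r sub ne by (cases "v \<in> X f"; cases "v \<in> X g") blast+
    next
      case 4
      then have "X g \<subseteq> X f" using mono[OF fg(2,1)] by blast
      moreover obtain m where "m \<in> H.side f" "m \<notin> H.side g" using 4 by blast
      ultimately show ?thesis
        using 4 r sub ne by (cases "v \<in> X f"; cases "v \<in> X g") blast+
    qed
  qed
  have "\<forall>v. \<exists>z. z \<in> VT' \<and> (\<forall>f\<in>ET'. (z \<in> H.side f) = (v \<in> X f))"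
    using H.oriented_sides_meet[OF meet] by blast
  then obtain \<psi> where \<psi>: "\<And>v. \<psi> v \<in> VT'" "\<And>v f. f \<in> ET' \<Longrightarrow> (\<psi> v \<in> H.side f) = (v \<in> X f)"
    by metis
  moreover have "\<psi> (Inl i) = Inl i" if i: "i \<in> W" for i
  proof (rule ccontr)
    assume ne: "\<psi> (Inl i) \<noteq> Inl i"
    have "Inl i \<in> VT'" using i H.terminals by auto
    with \<psi>(1) obtain f where f: "f \<in> ET'" "(\<psi> (Inl i) \<in> H.side f) \<noteq> (Inl i \<in> H.side f)"
      using ne by (rule H.separating_edge)
    \<comment> \<open>On terminals the cut \<open>X f\<close> agrees with the side of
      \<open>f\<close>, so no edge can separate the terminal from its image.\<close>
    have "X f \<inter> Inl ` W = H.side f \<inter> Inl ` W" by (rule minimal_mincutD(2)[OF X[OF f(1)]])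
    then show False using \<psi>(2)[OF f(1)] f(2) i by blast
  qed
  ultimately show ?thesis using that by blast
qed

end

section \<open>Transferring a hubbing to the demand tree\<close>

lemma conn_map:
  assumes "conn F x y" and "\<And>u v. {u, v} \<in> F \<Longrightarrow> conn F' (\<phi> u) (\<phi> v)"
  shows "conn F' (\<phi> x) (\<phi> y)"
  using assms(1)
proof (induction rule: conn_induct)
  case (step y z)
  then show ?case using assms(2) conn_trans by metis
qed simp

lemma embedding_conn:
  assumes "embedding V E W VT ET phv phe" "{u, v} \<in> ET"
  shows "conn (path_edges (phe {u, v})) (phv u) (phv v)"
proof -
  have "spath V E (phe {u, v}) (phv u) (phv v) \<or> spath V E (phe {u, v}) (phv v) (phv u)"
    using assms by (simp add: embedding_def)
  then show ?thesis by (auto dest: spath_conn intro: conn_sym)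
qed

text \<open>Double counting: the least admissible capacities of an embedding cost as much as its
  image paths weighted by \<beta>.\<close>

lemma hub_cost_decomposition:
  assumes "finite E" "finite F" "\<And>f. f \<in> F \<Longrightarrow> path_edges (phe f) \<subseteq> E"
  shows "(\<Sum>e\<in>E. c e * (\<Sum>f\<in>{f \<in> F. e \<in> path_edges (phe f)}. \<beta> f))
    = (\<Sum>f\<in>F. \<beta> f * sum c (path_edges (phe f)) :: real)"
proof -
  have "(\<Sum>e\<in>E. c e * (\<Sum>f\<in>{f \<in> F. e \<in> path_edges (phe f)}. \<beta> f))
      = (\<Sum>e\<in>E. \<Sum>f\<in>F. \<beta> f * (if e \<in> path_edges (phe f) then c e else 0))"
    using assms(2) by (auto intro!: sum.cong simp: sum_distrib_left sum.inter_filter)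
  also have "\<dots> = (\<Sum>f\<in>F. \<beta> f * (\<Sum>e\<in>E. if e \<in> path_edges (phe f) then c e else 0))"
    by (subst sum.swap) (simp add: sum_distrib_left)
  also have "\<dots> = (\<Sum>f\<in>F. \<beta> f * sum c (path_edges (phe f)))"
  proof (rule sum.cong)
    fix f assume "f \<in> F"
    then have "E \<inter> {e. e \<in> path_edges (phe f)} = path_edges (phe f)" using assms(3) by blast
    then show "\<beta> f * (\<Sum>e\<in>E. if e \<in> path_edges (phe f) then c e else 0) = \<beta> f * sum c (path_edges (phe f))"
      using assms(1) by (simp add: sum.If_cases)
  qed simp
  finally show ?thesis .
qed

lemma (in terminal_tree) embedding_path_edges:
  assumes "embedding G E W VT ET phv phe" "f \<in> ET"
  shows "path_edges (phe f) \<subseteq> E"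
proof -
  obtain u v where "f = {u, v}" using edge_ends assms(2) by blast
  then show ?thesis using assms unfolding embedding_def spath_iff by blast
qed

lemma sum_subset_UN_le:
  assumes "finite I" "\<And>i. i \<in> I \<Longrightarrow> finite (P i)" "A \<subseteq> (\<Union>i\<in>I. P i)"
    and c: "\<And>i e. i \<in> I \<Longrightarrow> e \<in> P i \<Longrightarrow> 0 \<le> (c e :: real)"
  shows "sum c A \<le> (\<Sum>i\<in>I. sum c (P i))"
proof -
  have "sum c A \<le> sum c (\<Union>i\<in>I. P i)"
    using assms by (intro sum_mono2) auto
  also have "\<dots> = sum c (snd ` Sigma I P)" by (intro sum.cong) force+
  also have "\<dots> \<le> sum (c \<circ> snd) (Sigma I P)"
    using assms by (intro sum_image_le) auto
  also have "\<dots> = (\<Sum>i\<in>I. sum c (P i))"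
    using assms by (simp add: sum.Sigma case_prod_beta)
  finally show ?thesis .
qed

text \<open>The cost of the new embedding is stated by its weighted path lengths, without
  capacities, since these take only finitely many values.\<close>

lemma (in hub_tree_pair) hubbing_transfer:
  assumes G: "is_graph G E" and c: "\<And>e. e \<in> E \<Longrightarrow> 0 \<le> c e"
    and hub: "hubbing U G E W VT' ET' phv' phe' u'"
  shows "\<exists>phv phe. embedding G E W VT ET phv phe \<and>
    (\<Sum>f\<in>ET. beta U W VT ET f * sum c (path_edges (phe f))) \<le> hub_cost E c u'"
proof -
  have finE: "finite E" and EG: "\<Union> E \<subseteq> G"
    using G finite_subset[of E "Pow G"] by (auto simp: is_graph_def)
  have emb: "embedding G E W VT' ET' phv' phe'"
    and cap: "\<And>e. e \<in> E \<Longrightarrow> (\<Sum>f\<in>{f \<in> ET'. e \<in> path_edges (phe' f)}. beta U W VT' ET' f) \<le> u' e"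
    using hub by (auto simp: hubbing_def)
  note phe'E = H.embedding_path_edges[OF emb]
  have "\<exists>X. mincut f X" for f
    using minimal_mincut_exists[OF T.finite_V] T.terminals by (metis inf_le2 order_trans)
  then obtain X where X: "\<And>f. mincut f (X f)" by metis
  then obtain \<psi> where \<psi>: "\<And>v. v \<in> VT \<Longrightarrow> \<psi> v \<in> VT'" "\<And>i. i \<in> W \<Longrightarrow> \<psi> (Inl i) = Inl i"
    "\<And>v f. v \<in> VT \<Longrightarrow> f \<in> ET' \<Longrightarrow> \<psi> v \<in> H.side f \<longleftrightarrow> v \<in> X f"
    using mincut_map[of X] by metis
  define phv where "phv = phv' \<circ> \<psi>"
  \<comment> \<open>As \<psi> pulls sides back to cuts, these contain all edges of \<open>T'\<close>
    on the path between the \<psi>-images of the ends of \<open>f\<close>.\<close>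
  define K where "K f = {f' \<in> ET'. f \<inter> X f' \<noteq> {} \<and> \<not> f \<subseteq> X f'}" for f
  have phvG: "phv v \<in> G" if "v \<in> VT" for v
    using emb \<psi>(1) that by (simp add: phv_def embedding_def)
  have "\<exists>p. (\<forall>v w. f = {v, w} \<longrightarrow> spath G E p (phv v) (phv w) \<or> spath G E p (phv w) (phv v))
      \<and> path_edges p \<subseteq> (\<Union>f'\<in>K f. path_edges (phe' f'))" if f: "f \<in> ET" for f
  proof -
    obtain u v where uv: "f = {u, v}" "u \<in> VT" "v \<in> VT" using T.edge_ends f by blast
    let ?P = "path_edges (tree_path VT' ET' (\<psi> u) (\<psi> v))" and ?F = "\<Union>f'\<in>K f. path_edges (phe' f')"
    note sp = H.tree_path_spath[OF \<psi>(1)[OF uv(2)] \<psi>(1)[OF uv(3)]]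
    have "?P \<subseteq> K f"
    proof
      fix f' assume f': "f' \<in> ?P"
      then have "f' \<in> ET'" using sp by (auto simp: spath_iff)
      then show "f' \<in> K f"
        using H.tree_path_side_iff[OF _ \<psi>(1)[OF uv(2)] \<psi>(1)[OF uv(3)]] f' \<psi>(3) uv by (auto simp: K_def)
    qed
    have "conn ?F (phv' x) (phv' y)" if "{x, y} \<in> ?P" for x y
    proof -
      have xy: "{x, y} \<in> K f" using that \<open>?P \<subseteq> K f\<close> by blast
      then have "{x, y} \<in> ET'" by (simp add: K_def)
      then have "conn (path_edges (phe' {x, y})) (phv' x) (phv' y)" by (rule embedding_conn[OF emb])
      then show ?thesis by (rule conn_mono) (use xy in blast)
    qed
    then have "conn ?F (phv' (\<psi> u)) (phv' (\<psi> v))" by (rule conn_map[OF spath_conn[OF sp]])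
    then have "conn ?F (phv u) (phv v)" by (simp add: phv_def)
    moreover have FE: "?F \<subseteq> E" using phe'E by (auto simp: K_def)
    then have "\<Union> ?F \<subseteq> G" using EG by blast
    \<comment> \<open>Joining the images of the edges may repeat vertices; a simple path within
      their union is chosen instead, so later only an inclusion of edge sets is available.\<close>
    ultimately obtain p where p: "spath G ?F p (phv u) (phv v)"
      using conn_spath phvG[OF uv(2)] by meson
    then have "spath G E p (phv u) (phv v)" "path_edges p \<subseteq> ?F" using FE by (auto simp: spath_iff)
    then show ?thesis using uv(1) by (intro exI[of _ p]) (auto simp: doubleton_eq_iff)
  qed
  then obtain phe where phe: "\<And>f v w. f \<in> ET \<Longrightarrow> f = {v, w} \<Longrightarrow>
      spath G E (phe f) (phv v) (phv w) \<or> spath G E (phe f) (phv w) (phv v)"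
    and pheK: "\<And>f. f \<in> ET \<Longrightarrow> path_edges (phe f) \<subseteq> (\<Union>f'\<in>K f. path_edges (phe' f'))"
    by metis
  have "embedding G E W VT ET phv phe"
    using phvG phe \<psi>(2) emb by (auto simp: embedding_def phv_def)
  moreover have "(\<Sum>f\<in>ET. beta U W VT ET f * sum c (path_edges (phe f))) \<le> hub_cost E c u'"
  proof -
    define C where "C f' = sum c (path_edges (phe' f'))" for f'
    have Cpos: "0 \<le> C f'" if "f' \<in> ET'" for f'
      unfolding C_def using phe'E[OF that] c by (intro sum_nonneg) auto
    have Cphe: "sum c (path_edges (phe f)) \<le> sum C (K f)" if f: "f \<in> ET" for f
      unfolding C_def using pheK[OF f] phe'E c H.finite_E
      by (intro sum_subset_UN_le) (auto simp: K_def)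
    have Kpos: "0 \<le> sum C (K f)" for f using Cpos by (intro sum_nonneg) (auto simp: K_def)
    have "(\<Sum>f\<in>ET. beta U W VT ET f * sum c (path_edges (phe f))) \<le> (\<Sum>f\<in>ET. b f * sum C (K f))"
    proof (rule sum_mono)
      fix f assume f: "f \<in> ET"
      have "beta U W VT ET f * sum c (path_edges (phe f)) \<le> beta U W VT ET f * sum C (K f)"
        using Cphe[OF f] T.beta_nonneg[OF b_nonneg] by (intro mult_left_mono)
      also have "\<dots> \<le> b f * sum C (K f)"
        using T.beta_le_capacity[OF b_nonneg f] Kpos by (intro mult_right_mono)
      finally show "beta U W VT ET f * sum c (path_edges (phe f)) \<le> b f * sum C (K f)" .
    qed
    \<comment> \<open>Regroup by \<open>f'\<close>: the capacities of all edges \<open>f\<close>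
      with \<open>f'\<close> in \<open>K f\<close> add up to the cut of \<open>X f'\<close>.\<close>
    also have "\<dots> = (\<Sum>f\<in>ET. \<Sum>f'\<in>ET'. C f' * (if f \<inter> X f' \<noteq> {} \<and> \<not> f \<subseteq> X f' then b f else 0))"
      using H.finite_E by (auto intro!: sum.cong simp: K_def sum_distrib_left sum.inter_filter mult.commute)
    also have "\<dots> = (\<Sum>f'\<in>ET'. C f' * cut ET b (X f'))"
      by (subst sum.swap) (simp add: cut_def sum_distrib_left)
    also have "\<dots> \<le> (\<Sum>f'\<in>ET'. C f' * beta U W VT' ET' f')"
      using mincut_le_beta[OF _ X] Cpos by (intro sum_mono mult_left_mono) auto
    also have "\<dots> = (\<Sum>e\<in>E. c e * (\<Sum>f\<in>{f \<in> ET'. e \<in> path_edges (phe' f)}. beta U W VT' ET' f))"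
      using hub_cost_decomposition[OF finE H.finite_E phe'E, where c = c and \<beta> = "beta U W VT' ET'"]
      by (simp add: C_def mult.commute)
    also have "\<dots> \<le> hub_cost E c u'"
      unfolding hub_cost_def using cap c by (intro sum_mono mult_left_mono) auto
    finally show ?thesis .
  qed
  ultimately show ?thesis by blast
qed

section \<open>Attainment of the minimum\<close>

lemma hub_tree_rooted:
  assumes "hub_tree W VT ET"
  obtains r where "terminal_tree VT ET r W"
proof -
  obtain r where "r \<in> VT" using assms by (auto simp: hub_tree_def is_tree_def)
  moreover have "Inl ` W \<subseteq> VT" using assms by (auto simp: hub_tree_def leaves_def)
  ultimately have "terminal_tree VT ET r W"
    using assms by unfold_locales (auto simp: hub_tree_def)
  then show ?thesis using that by blast
qed

text \<open>The assumed hubbing rules out graphs that admit no embedding at all, where there would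
  be nothing to minimise over.\<close>

theorem theorem2:
  fixes V :: "'a set" and E :: "'a set set" and c :: "'a set \<Rightarrow> real" and W :: "'a set"
    and VT :: "('a + nat) set" and ET :: "('a + nat) set set" and b :: "('a + nat) set \<Rightarrow> real"
  assumes "is_graph V E"
    and "\<forall>e\<in>E. 0 \<le> c e"
    and "W \<subseteq> V"
    and "hub_tree W VT ET"
    and "\<forall>f\<in>ET. 0 \<le> b f"
    and "\<exists>VT' ET' phv phe u. hub_tree W VT' ET' \<and> hubbing (UTb W VT ET b) V E W VT' ET' phv phe u"
  shows "\<exists>phv phe u. hubbing (UTb W VT ET b) V E W VT ET phv phe u \<and>
           (\<forall>VT' ET' phv' phe' u'. hub_tree W VT' ET' \<and> hubbing (UTb W VT ET b) V E W VT' ET' phv' phe' u'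
               \<longrightarrow> hub_cost E c u \<le> hub_cost E c u')"
proof -
  let ?U = "UTb W VT ET b"
  obtain r where T: "terminal_tree VT ET r W" using hub_tree_rooted assms(4) by blast
  interpret T: terminal_tree VT ET r W by (rule T)
  have b: "\<And>f. f \<in> ET \<Longrightarrow> 0 \<le> b f" and c: "\<And>e. e \<in> E \<Longrightarrow> 0 \<le> c e" using assms by auto
  have finE: "finite E" using assms(1) finite_subset[of E "Pow V"] by (auto simp: is_graph_def)
  define cost where "cost phe = (\<Sum>f\<in>ET. beta ?U W VT ET f * sum c (path_edges (phe f)))" for phe
  have transfer: "\<exists>phv phe. embedding V E W VT ET phv phe \<and> cost phe \<le> hub_cost E c u'"
    if hub: "hub_tree W VT' ET'" "hubbing ?U V E W VT' ET' phv' phe' u'" for VT' ET' phv' phe' u'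
  proof -
    obtain r' where "terminal_tree VT' ET' r' W" using hub_tree_rooted[OF hub(1)] by blast
    then interpret hub_tree_pair VT ET r VT' ET' r' W b
      by (intro hub_tree_pair.intro hub_tree_pair_axioms.intro T b)
    show ?thesis unfolding cost_def using hubbing_transfer[OF assms(1) c hub(2)] .
  qed
  define K where "K = {cost phe | phv phe. embedding V E W VT ET phv phe}"
  \<comment> \<open>The cost depends only on the edge sets of the image paths, which are subsets of
    the finite set \<open>E\<close>; hence there are finitely many costs although the maps
    themselves range over infinite types.\<close>
  have "K \<subseteq> (\<lambda>g. \<Sum>f\<in>ET. beta ?U W VT ET f * sum c (g f)) ` (ET \<rightarrow>\<^sub>E Pow E)"
  proof
    fix k assume "k \<in> K"
    then obtain phv phe where k: "k = cost phe" and "embedding V E W VT ET phv phe"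
      by (auto simp: K_def)
    then have "restrict (path_edges \<circ> phe) ET \<in> ET \<rightarrow>\<^sub>E Pow E" using T.embedding_path_edges by fastforce
    moreover have "k = (\<Sum>f\<in>ET. beta ?U W VT ET f * sum c (restrict (path_edges \<circ> phe) ET f))"
      unfolding k cost_def by (intro sum.cong) auto
    ultimately show "k \<in> (\<lambda>g. \<Sum>f\<in>ET. beta ?U W VT ET f * sum c (g f)) ` (ET \<rightarrow>\<^sub>E Pow E)" by blast
  qed
  then have finK: "finite K"
    by (rule finite_subset) (use finE T.finite_E in \<open>auto intro!: finite_PiE\<close>)
  obtain VT0 ET0 phv0 phe0 u0 where "hub_tree W VT0 ET0" "hubbing ?U V E W VT0 ET0 phv0 phe0 u0"
    using assms(6) by blast
  from transfer[OF this] have "K \<noteq> {}" unfolding K_def by blast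
  with finK obtain k where k: "k \<in> K" "\<And>x. x \<in> K \<Longrightarrow> k \<le> x"
    using Min_in Min_le by blast
  then obtain phv phe where emb: "embedding V E W VT ET phv phe" and "k = cost phe"
    unfolding K_def by blast
  with k have least: "\<And>x. x \<in> K \<Longrightarrow> cost phe \<le> x" by simp
  \<comment> \<open>The least capacities that the embedding admits, so that the hubbing costs
    exactly \<open>cost phe\<close>.\<close>
  define u where "u e = (\<Sum>f\<in>{f \<in> ET. e \<in> path_edges (phe f)}. beta ?U W VT ET f)" for e
  have "hubbing ?U V E W VT ET phv phe u"
    using emb T.beta_nonneg[OF b] by (auto simp: hubbing_def u_def intro!: sum_nonneg)
  moreover have "hub_cost E c u = cost phe"
    unfolding hub_cost_def u_def cost_def
    by (rule hub_cost_decomposition[OF finE T.finite_E T.embedding_path_edges[OF emb]])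
  moreover have "cost phe \<le> hub_cost E c u'"
    if hub: "hub_tree W VT' ET'" "hubbing ?U V E W VT' ET' phv' phe' u'" for VT' ET' phv' phe' u'
  proof -
    obtain phv1 phe1 where *: "embedding V E W VT ET phv1 phe1" "cost phe1 \<le> hub_cost E c u'"
      using transfer[OF hub] by blast
    then have "cost phe \<le> cost phe1" using least unfolding K_def by blast
    then show ?thesis using *(2) by linarith
  qed
  ultimately show ?thesis by (intro exI[of _ phv] exI[of _ phe] exI[of _ u] conjI allI impI) (simp, elim conjE, simp)
qed

end
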